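(* Let $\mathcal{T}\subset\mathbb{R}^n$ be a nonempty finite $\mathcal{S}_n$-invariant set and let $\hat{\mathcal{T}}$ be a set of orbit representatives for $\mathcal{T}$. Then the symmetric cone $C^{\mathcal{S}}_{\mathrm{SAGE}}(\mathcal{T})$ decomposes as the Minkowski sum $$C^{\mathcal{S}}_{\mathrm{SAGE}}(\mathcal{T})=\sum_{\hat\beta\in\hat{\mathcal{T}}}\ \sum_{\substack{\lambda\in\Lambda(\mathcal{T})\\ \lambda^-=\hat\beta}}C^{\mathcal{S}}_{\mathrm{SAGE}}(\lambda)\;+\;\sum_{\hat\alpha\in\hat{\mathcal{T}}}\mathbb{R}_+\sum_{\rho\in\mathcal{S}_n/\operatorname{Stab}(\hat\alpha)}\rho\exp(\langle\hat\alpha,x\rangle).$$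
   Context: The symmetric group $\mathcal{S}_n$ acts on $\mathbb{R}^n$ by permuting coordinates, hence on exponent vectors and on signomials; $\rho f$ denotes the image of $f$ under $\rho$ (so $\rho$ maps $\exp(\langle\alpha,x\rangle)$ to $\exp(\langle\rho(\alpha),x\rangle)$). $\operatorname{Stab}(\alpha)=\{\sigma\in\mathcal{S}_n:\sigma(\alpha)=\alpha\}$. For a finite set $\mathcal{A}\subset\mathbb{R}^n$ and $\beta\in\mathbb{R}^n\setminus\mathcal{A}$, $C_{\mathrm{AGE}}(\mathcal{A},\beta)$ is the set of signomials $\sum_{\alpha\in\mathcal{A}}c_\alpha e^{\langle\alpha,x\rangle}+c_\beta e^{\langle\beta,x\rangle}$ with $c_\alpha\ge0$ for $\alpha\in\mathcal{A}$, $c_\beta\in\mathbb{R}$, that are nonnegative on $\mathbb{R}^n$. $C_{\mathrm{SAGE}}(\mathcal{T})=\sum_{\beta\in\mathcal{T}}C_{\mathrm{AGE}}(\mathcal{T}\setminus\{\beta\},\beta)$, and $C^{\mathcal{S}}_{\mathrm{SAGE}}(\mathcal{T})$ is the cone of $\mathcal{S}_n$-invariant signomials in $C_{\mathrm{SAGE}}(\mathcal{T})$. A simplicial circuit is a nonzero vector $\nu\in\mathbb{R}^{\mathcal{T}}$ whose components sum to zero, whose positive support $\nu^+=\{\alpha\in\mathcal{T}:\nu_\alpha>0\}$ is affinely independent, and which has exactly one negative component, at an element $\beta=:\nu^-$ satisfying $(\sum_{\alpha\in\nu^+}\nu_\alpha)\beta=\sum_{\alpha\in\nu^+}\nu_\alpha\alpha$.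 It is normalized if its positive components sum to $1$ (so the negative component is $-1$). $\Lambda(\mathcal{T})$ is the set of normalized simplicial circuits of $\mathcal{T}$. For $\lambda\in\Lambda(\mathcal{T})$, the symmetrized $\lambda$-witnessed cone is $$C^{\mathcal{S}}_{\mathrm{SAGE}}(\lambda)=\Bigl\{\sum_{\rho\in\mathcal{S}_n}\rho g\ :\ g\in C_{\mathrm{AGE}}(\lambda^+,\lambda^-)\Bigr\}.$$ *)

theory Defs
  imports "HOL-Analysis.Analysis" "HOL-Library.Set_Algebras" "HOL-Library.Function_Algebras"
begin

text \<open>
  A signomial is the function it induces on \<open>real ^ 'n\<close>. Sums of functions are pointwise
  (\<open>Function_Algebras\<close>), and \<open>+\<close> and \<open>\<Sum>\<close> on sets of functions are Minkowski sums
  (\<open>Set_Algebras\<close>); the empty Minkowski sum is \<open>{0}\<close>.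
\<close>

type_synonym 'n signomial = "real ^ 'n \<Rightarrow> real"

definition expf :: "real ^ 'n \<Rightarrow> 'n::finite signomial" where
  "expf \<alpha> = (\<lambda>x. exp (\<alpha> \<bullet> x))"


subsection \<open>The symmetric group on the coordinates\<close>

definition Sym :: "('n \<Rightarrow> 'n) set" where
  "Sym = {\<rho>. \<rho> permutes UNIV}"

text \<open>The inverses make both of the following left actions.\<close>

definition perm_vec :: "('n \<Rightarrow> 'n) \<Rightarrow> real ^ 'n \<Rightarrow> real ^ ('n::finite)" where
  "perm_vec \<rho> x = (\<chi> i. x $ inv \<rho> i)"

definition perm_sig :: "('n \<Rightarrow> 'n) \<Rightarrow> 'n::finite signomial \<Rightarrow> 'n signomial" where
  "perm_sig \<rho> f = (\<lambda>x. f (perm_vec (inv \<rho>) x))"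

definition sym_invariant_set :: "(real ^ 'n::finite) set \<Rightarrow> bool" where
  "sym_invariant_set T \<longleftrightarrow> (\<forall>\<rho>\<in>Sym. perm_vec \<rho> ` T = T)"

definition orbit_representatives :: "(real ^ 'n::finite) set \<Rightarrow> (real ^ 'n) set \<Rightarrow> bool" where
  "orbit_representatives T R \<longleftrightarrow>
     R \<subseteq> T \<and> (\<forall>\<alpha>\<in>T. \<exists>!r. r \<in> R \<and> (\<exists>\<rho>\<in>Sym. \<alpha> = perm_vec \<rho> r))"

definition Stab :: "real ^ 'n \<Rightarrow> ('n::finite \<Rightarrow> 'n) set" where
  "Stab \<alpha> = {\<sigma> \<in> Sym. perm_vec \<sigma> \<alpha> = \<alpha>}"

definition Stab_cosets :: "real ^ 'n \<Rightarrow> ('n::finite \<Rightarrow> 'n) set set" where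
  "Stab_cosets \<alpha> = (\<lambda>\<rho>. (\<lambda>\<sigma>. \<rho> \<circ> \<sigma>) ` Stab \<alpha>) ` Sym"

text \<open>
  The sum of \<open>\<rho> exp(\<langle>\<alpha>, x\<rangle>)\<close> over \<open>S\<^sub>n / Stab \<alpha>\<close>. The choice of \<open>\<rho>\<close> in its coset is
  immaterial, see \<open>perm_sig_expf_coset\<close> below.
\<close>

definition orbit_sum_exp :: "real ^ 'n \<Rightarrow> 'n::finite signomial" where
  "orbit_sum_exp \<alpha> = (\<Sum>C\<in>Stab_cosets \<alpha>. perm_sig (SOME \<rho>. \<rho> \<in> C) (expf \<alpha>))"


subsection \<open>AGE and SAGE cones\<close>

text \<open>Only meaningful for finite \<open>A\<close> and \<open>\<beta> \<notin> A\<close>.\<close>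

definition C_AGE :: "(real ^ 'n) set \<Rightarrow> real ^ 'n \<Rightarrow> 'n::finite signomial set" where
  "C_AGE A \<beta> = {f. (\<exists>c. (\<forall>\<alpha>\<in>A. c \<alpha> \<ge> 0) \<and>
       f = (\<lambda>x. (\<Sum>\<alpha>\<in>A. c \<alpha> * expf \<alpha> x) + c \<beta> * expf \<beta> x)) \<and> (\<forall>x. f x \<ge> 0)}"

definition C_SAGE :: "(real ^ 'n) set \<Rightarrow> 'n::finite signomial set" where
  "C_SAGE T = (\<Sum>\<beta>\<in>T. C_AGE (T - {\<beta>}) \<beta>)"

definition C_SAGE_sym :: "(real ^ 'n) set \<Rightarrow> 'n::finite signomial set" where
  "C_SAGE_sym T = {f \<in> C_SAGE T. \<forall>\<rho>\<in>Sym. perm_sig \<rho> f = f}"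


subsection \<open>Simplicial circuits\<close>

text \<open>Vectors in \<open>\<real>\<^sup>T\<close> are functions on \<open>real ^ 'n\<close> that vanish outside \<open>T\<close>.\<close>

definition circuit_pos :: "(real ^ 'n \<Rightarrow> real) \<Rightarrow> (real ^ 'n::finite) set" where
  "circuit_pos \<nu> = {\<alpha>. \<nu> \<alpha> > 0}"

definition circuit_neg :: "(real ^ 'n \<Rightarrow> real) \<Rightarrow> real ^ 'n::finite" where
  "circuit_neg \<nu> = (THE \<beta>. \<nu> \<beta> < 0)"

definition simplicial_circuit :: "(real ^ 'n::finite) set \<Rightarrow> (real ^ 'n \<Rightarrow> real) \<Rightarrow> bool" where
  "simplicial_circuit T \<nu> \<longleftrightarrow>
     (\<forall>\<alpha>. \<alpha> \<notin> T \<longrightarrow> \<nu> \<alpha> = 0) \<and> (\<exists>\<alpha>. \<nu> \<alpha> \<noteq> 0) \<and> (\<Sum>\<alpha>\<in>T. \<nu> \<alpha>) = 0 \<and>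
     \<not> affine_dependent (circuit_pos \<nu>) \<and> (\<exists>!\<beta>. \<nu> \<beta> < 0) \<and>
     (\<Sum>\<alpha>\<in>circuit_pos \<nu>. \<nu> \<alpha>) *\<^sub>R circuit_neg \<nu> = (\<Sum>\<alpha>\<in>circuit_pos \<nu>. \<nu> \<alpha> *\<^sub>R \<alpha>)"

definition normalized_circuits :: "(real ^ 'n::finite) set \<Rightarrow> (real ^ 'n \<Rightarrow> real) set" where
  "normalized_circuits T = {\<nu>. simplicial_circuit T \<nu> \<and> (\<Sum>\<alpha>\<in>circuit_pos \<nu>. \<nu> \<alpha>) = 1}"

definition C_SAGE_sym_circuit :: "(real ^ 'n \<Rightarrow> real) \<Rightarrow> 'n::finite signomial set" where
  "C_SAGE_sym_circuit \<nu> =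
     {\<Sum>\<rho>\<in>Sym. perm_sig \<rho> g | g. g \<in> C_AGE (circuit_pos \<nu>) (circuit_neg \<nu>)}"

definition nonneg_ray :: "'n::finite signomial \<Rightarrow> 'n signomial set" where
  "nonneg_ray f = {(\<lambda>x. t * f x) | t. t \<ge> 0}"


subsection \<open>Consistency of the definitions\<close>

lemma perm_sig_expf:
  assumes "\<rho> \<in> Sym"
  shows "perm_sig \<rho> (expf \<alpha>) = expf (perm_vec \<rho> (\<alpha> :: real ^ 'n::finite))"
proof
  fix x :: "real ^ 'n"
  have b: "bij \<rho>" using assms by (simp add: Sym_def permutes_bij)
  have "\<alpha> \<bullet> perm_vec (inv \<rho>) x = (\<Sum>i\<in>UNIV. \<alpha> $ i * x $ \<rho> i)"
    by (simp add: perm_vec_def inner_vec_def inv_inv_eq[OF b])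
  also have "\<dots> = (\<Sum>i\<in>UNIV. \<alpha> $ inv \<rho> i * x $ i)"
    using b by (intro sum.reindex_bij_witness[of _ "inv \<rho>" \<rho>])
      (simp_all add: bij_is_inj bij_is_surj surj_f_inv_f)
  also have "\<dots> = perm_vec \<rho> \<alpha> \<bullet> x"
    by (simp add: perm_vec_def inner_vec_def)
  finally show "perm_sig \<rho> (expf \<alpha>) x = expf (perm_vec \<rho> \<alpha>) x"
    by (simp add: perm_sig_def expf_def)
qed

lemma perm_vec_comp:
  assumes "\<rho> \<in> Sym" "\<sigma> \<in> Sym"
  shows "perm_vec (\<rho> \<circ> \<sigma>) x = perm_vec \<rho> (perm_vec \<sigma> x)"
  using assms by (simp add: perm_vec_def Sym_def o_inv_distrib permutes_bij)

lemma perm_sig_expf_coset: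
  assumes "C \<in> Stab_cosets \<alpha>" "\<rho> \<in> C" "\<tau> \<in> C"
  shows "perm_sig \<rho> (expf \<alpha>) = perm_sig \<tau> (expf \<alpha>)"
proof -
  obtain \<pi> where \<pi>: "\<pi> \<in> Sym" "C = (\<lambda>\<sigma>. \<pi> \<circ> \<sigma>) ` Stab \<alpha>"
    using assms(1) by (auto simp: Stab_cosets_def)
  have "perm_sig \<rho>' (expf \<alpha>) = expf (perm_vec \<pi> \<alpha>)" if r: "\<rho>' \<in> C" for \<rho>'
  proof -
    obtain \<sigma> where \<sigma>: "\<sigma> \<in> Sym" "perm_vec \<sigma> \<alpha> = \<alpha>" "\<rho>' = \<pi> \<circ> \<sigma>"
      using r unfolding \<pi>(2) Stab_def by blast
    have "\<rho>' \<in> Sym" using \<sigma> \<pi> by (auto simp: Sym_def intro: permutes_compose)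
    then show ?thesis using \<sigma> \<pi> by (simp add: perm_sig_expf perm_vec_comp)
  qed
  then show ?thesis using assms by simp
qed

lemma circuit_neg_iff:
  assumes "simplicial_circuit T \<nu>"
  shows "\<nu> \<beta> < 0 \<longleftrightarrow> \<beta> = circuit_neg \<nu>"
proof -
  have ex1: "\<exists>!\<beta>. \<nu> \<beta> < 0" using assms by (simp add: simplicial_circuit_def)
  show ?thesis
    unfolding circuit_neg_def using theI'[OF ex1] the1_equality[OF ex1] by metis
qed

lemma circuit_pos_subset: "simplicial_circuit T \<nu> \<Longrightarrow> circuit_pos \<nu> \<subseteq> T"
  unfolding simplicial_circuit_def circuit_pos_def by (metis (mono_tags) mem_Collect_eq less_irrefl subsetI)

lemma normalized_circuit_neg_value:
  assumes "finite T" "\<nu> \<in> normalized_circuits T"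
  shows "\<nu> (circuit_neg \<nu>) = -1"
proof -
  have s: "simplicial_circuit T \<nu>" and n: "(\<Sum>\<alpha>\<in>circuit_pos \<nu>. \<nu> \<alpha>) = 1"
    using assms(2) by (auto simp: normalized_circuits_def)
  let ?b = "circuit_neg \<nu>"
  have b: "\<nu> ?b < 0" using circuit_neg_iff[OF s] by blast
  have bT: "?b \<in> T" using b s unfolding simplicial_circuit_def by (metis less_irrefl)
  have nb: "?b \<notin> circuit_pos \<nu>" using b by (simp add: circuit_pos_def)
  have sub: "circuit_pos \<nu> \<subseteq> T" by (rule circuit_pos_subset[OF s])
  have z: "\<nu> \<alpha> = 0" if "\<alpha> \<in> T - insert ?b (circuit_pos \<nu>)" for \<alpha>
    using that circuit_neg_iff[OF s, of \<alpha>] by (auto simp: circuit_pos_def)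
  have "0 = (\<Sum>\<alpha>\<in>T. \<nu> \<alpha>)" using s by (simp add: simplicial_circuit_def)
  also have "\<dots> = (\<Sum>\<alpha>\<in>insert ?b (circuit_pos \<nu>). \<nu> \<alpha>)"
    using assms(1) sub bT z by (intro sum.mono_neutral_right) auto
  also have "\<dots> = \<nu> ?b + 1"
    using nb n finite_subset[OF sub assms(1)] by simp
  finally show ?thesis by simp
qed

text \<open>A \<open>\<Sum>\<close> over an infinite index set would be \<open>0\<close>; this does not happen for circuits.\<close>

lemma finite_normalized_circuits:
  assumes T: "finite T"
  shows "finite (normalized_circuits T)"
proof (rule inj_on_finite[where B = "Pow T \<times> T"])
  show "inj_on (\<lambda>\<nu>. (circuit_pos \<nu>, circuit_neg \<nu>)) (normalized_circuits T)"
  proof (rule inj_onI)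
    fix \<nu> \<mu> assume \<nu>: "\<nu> \<in> normalized_circuits T" and \<mu>: "\<mu> \<in> normalized_circuits T"
      and eq: "(circuit_pos \<nu>, circuit_neg \<nu>) = (circuit_pos \<mu>, circuit_neg \<mu>)"
    define P where "P = circuit_pos \<nu>"
    have P: "circuit_pos \<nu> = P" "circuit_pos \<mu> = P" and N: "circuit_neg \<nu> = circuit_neg \<mu>"
      using eq by (auto simp: P_def)
    have s: "simplicial_circuit T \<nu>" "simplicial_circuit T \<mu>"
      using \<nu> \<mu> by (auto simp: normalized_circuits_def)
    have fP: "finite P" using circuit_pos_subset[OF s(1)] T P finite_subset by blast
    have sums: "sum \<nu> P = 1" "sum \<mu> P = 1"
      using \<nu> \<mu> P by (auto simp: normalized_circuits_def)
    have "(\<Sum>\<alpha>\<in>P. \<nu> \<alpha> *\<^sub>R \<alpha>) = (\<Sum>\<alpha>\<in>P. \<mu> \<alpha> *\<^sub>R \<alpha>)"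
      using s sums N P by (simp add: simplicial_circuit_def)
    then have "(\<Sum>\<alpha>\<in>P. (\<nu> \<alpha> - \<mu> \<alpha>) *\<^sub>R \<alpha>) = 0" "(\<Sum>\<alpha>\<in>P. \<nu> \<alpha> - \<mu> \<alpha>) = 0"
      using sums by (auto simp: scaleR_diff_left sum_subtractf)
    moreover have "\<not> affine_dependent P" using s P by (auto simp: simplicial_circuit_def)
    ultimately have "\<not> (\<exists>\<alpha>\<in>P. \<nu> \<alpha> - \<mu> \<alpha> \<noteq> 0)"
      unfolding affine_dependent_explicit_finite[OF fP] by blast
    then have onP: "\<forall>\<alpha>\<in>P. \<nu> \<alpha> = \<mu> \<alpha>" by simp
    show "\<nu> = \<mu>"
    proof
      fix \<alpha>
      consider "\<alpha> \<in> P" | "\<alpha> = circuit_neg \<nu>" | "\<alpha> \<notin> P" "\<alpha> \<noteq> circuit_neg \<nu>" by blast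
      then show "\<nu> \<alpha> = \<mu> \<alpha>"
      proof cases
        case 1 then show ?thesis using onP by blast
      next
        case 2 then show ?thesis
          using normalized_circuit_neg_value[OF T \<nu>] normalized_circuit_neg_value[OF T \<mu>] N by simp
      next
        case 3
        have "\<not> \<nu> \<alpha> > 0" "\<not> \<mu> \<alpha> > 0" using 3(1) P by (auto simp: circuit_pos_def)
        moreover have "\<not> \<nu> \<alpha> < 0" "\<not> \<mu> \<alpha> < 0"
          using 3(2) circuit_neg_iff[OF s(1)] circuit_neg_iff[OF s(2)] N by auto
        ultimately show ?thesis by linarith
      qed
    qed
  qed
  show "(\<lambda>\<nu>. (circuit_pos \<nu>, circuit_neg \<nu>)) ` normalized_circuits T \<subseteq> Pow T \<times> T"
  proof clarsimp
    fix \<nu> assume "\<nu> \<in> normalized_circuits T"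
    then have s: "simplicial_circuit T \<nu>" by (simp add: normalized_circuits_def)
    have "\<nu> (circuit_neg \<nu>) < 0" using circuit_neg_iff[OF s] by blast
    then have "circuit_neg \<nu> \<in> T" using s unfolding simplicial_circuit_def by (metis less_irrefl)
    then show "circuit_pos \<nu> \<subseteq> T \<and> circuit_neg \<nu> \<in> T" using circuit_pos_subset[OF s] by blast
  qed
  show "finite (Pow T \<times> T)" using T by simp
qed

end

theory Submission
  imports Defs
begin

text \<open>
  The inclusion of the right-hand side in the symmetric SAGE cone holds because symmetrizing maps the
  SAGE cone of an invariant set to itself, and because the symmetrization of an exponential is a
  positive multiple of its orbit sum (\<open>symmetrize_expf_eq_orbit_sum\<close>).

  For the converse, let \<open>f\<close> be an invariant sum of AGE signomials \<open>f\<^sub>\<beta>\<close>. Averaging over the group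
  leaves \<open>f\<close> unchanged, so \<open>f\<close> is up to a positive factor the sum of the symmetrizations of the
  \<open>f\<^sub>\<beta>\<close>. The symmetrization does not change when \<open>f\<^sub>\<beta>\<close> is first moved by a permutation, so \<open>\<beta>\<close>
  may be taken to be an orbit representative (\<open>C_SAGE_sym_subset_cone\<close>).

  It remains to decompose a single AGE signomial into signomials supported on simplicial circuits and
  nonnegative multiples of exponentials (\<open>C_AGE_subset_circuit_cone\<close>). Its nonnegativity is certified
  by weights \<open>w\<close> on the exponents other than \<open>\<beta>\<close> that have barycenter \<open>\<beta>\<close> and satisfy an entropy
  bound in terms of the coefficients (\<open>entropy_certificate\<close>). Given the weights, the nonnegativity
  follows by summing tangent line inequalities of the exponential function, and the resulting
  signomial depends affinely on \<open>w\<close>. Writing \<open>w\<close> as a convex combination of vertices of the polytope of such weights, which are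
  precisely the normalized circuits, decomposes the signomial
  (\<open>tangent_signomial_in_circuit_cone\<close>).
\<close>

section \<open>Duality for sums of exponentials\<close>

text \<open>
  Sequential compactness of the unit box with coordinates in \<open>A\<close>: refine the subsequence one
  coordinate at a time.
\<close>

lemma unit_box_sequence_has_convergent_subsequence:
  fixes \<nu> :: "nat \<Rightarrow> 'a \<Rightarrow> real"
  assumes "finite A" and "\<And>k a. a \<in> A \<Longrightarrow> \<nu> k a \<in> {0..1}"
  shows "\<exists>r l. strict_mono (r :: nat \<Rightarrow> nat) \<and> (\<forall>a\<in>A. (\<lambda>k. \<nu> (r k) a) \<longlonglongrightarrow> l a)"
  using assms
proof (induction A rule: finite_induct)
  case empty
  show ?case by (intro exI[of _ id]) (simp add: strict_mono_def)
next
  case (insert b A)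
  then obtain r l where r: "strict_mono (r :: nat \<Rightarrow> nat)"
    and l: "\<And>a. a \<in> A \<Longrightarrow> (\<lambda>k. \<nu> (r k) a) \<longlonglongrightarrow> l a"
    by blast
  have "\<forall>k. \<nu> (r k) b \<in> {0..1}" using insert.prems by blast
  then obtain m s where s: "strict_mono (s :: nat \<Rightarrow> nat)"
    and m: "((\<lambda>k. \<nu> (r k) b) \<circ> s) \<longlonglongrightarrow> m"
    using compact_Icc[of 0 "1 :: real", unfolded compact_def] by metis
  have "(\<lambda>k. \<nu> ((r \<circ> s) k) a) \<longlonglongrightarrow> (l(b := m)) a" if "a \<in> insert b A" for a
  proof (cases "a = b")
    case True
    then show ?thesis using m by (simp add: o_def)
  next
    case False
    then have "a \<in> A" using that by blast
    from LIMSEQ_subseq_LIMSEQ[OF l[OF this] s] show ?thesis using False by (simp add: o_def)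
  qed
  then show ?case using strict_mono_o[OF r s] by blast
qed

lemma continuous_on_x_ln_x: "continuous_on {0..} (\<lambda>t::real. t * ln t)"
  unfolding continuous_on_def
proof
  fix x :: real assume "x \<in> {0..}"
  then consider "x = 0" | "x > 0" by force
  then show "((\<lambda>t. t * ln t) \<longlongrightarrow> x * ln x) (at x within {0..})"
  proof cases
    case 1
    have "((\<lambda>t. - (ln (inverse t) / inverse t)) \<longlongrightarrow> (- 0 :: real)) (at_right 0)"
      by (intro tendsto_minus filterlim_compose[OF ln_x_over_x_tendsto_0 filterlim_inverse_at_top_right])
    then have "((\<lambda>t::real. t * ln t) \<longlongrightarrow> 0) (at_right 0)"
      by (rule filterlim_cong[THEN iffD1, rotated -1])
        (auto simp: ln_inverse ln_div field_simps intro!: eventually_mono[OF eventually_at_right_less])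
    then show ?thesis using 1 by (simp add: at_within_Ici_at_right)
  next
    case 2
    then have "((\<lambda>t. t * ln t) \<longlongrightarrow> x * ln x) (at x)" by (auto intro!: tendsto_intros)
    then show ?thesis using tendsto_within_subset by blast
  qed
qed

text \<open>
  The point is a minimizer of the exponential sum plus \<open>e / 2 * (x \<bullet> x)\<close>: the quadratic term makes
  the function coercive, so a minimizer exists even when the exponential sum only approaches its
  infimum at infinity. The equation says that the gradient vanishes; the bound compares the minimum
  with the value at the origin.
\<close>

lemma regularized_exponential_sum_critical_point:
  fixes A :: "'a::euclidean_space set" and c :: "'a \<Rightarrow> real"
  assumes A: "finite A" and c: "\<And>\<alpha>. \<alpha> \<in> A \<Longrightarrow> 0 \<le> c \<alpha>" and e: "0 < e"
  shows "\<exists>x. (\<Sum>\<alpha>\<in>A. (c \<alpha> * exp (\<alpha> \<bullet> x)) *\<^sub>R \<alpha>) = - (e *\<^sub>R x) \<and> e * (x \<bullet> x) \<le> 2 * sum c A"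
proof -
  define g where "g = (\<lambda>x. \<Sum>\<alpha>\<in>A. c \<alpha> * exp (\<alpha> \<bullet> x))"
  define \<phi> where "\<phi> = (\<lambda>x. g x + e / 2 * (x \<bullet> x))"
  have g0: "0 \<le> g x" for x unfolding g_def by (intro sum_nonneg) (simp add: c)
  have \<phi>0: "\<phi> 0 = sum c A" by (simp add: \<phi>_def g_def)
  have M: "0 \<le> sum c A" by (intro sum_nonneg c)
  define R where "R = sqrt (2 * sum c A / e)"
  have R0: "0 \<le> R" and R2: "R\<^sup>2 = 2 * sum c A / e" using M e by (auto simp: R_def)
  have "continuous_on (cball 0 R) \<phi>"
    unfolding \<phi>_def g_def by (intro continuous_intros)
  then obtain x where x: "x \<in> cball 0 R" "\<And>y. y \<in> cball 0 R \<Longrightarrow> \<phi> x \<le> \<phi> y"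
    using continuous_attains_inf[OF compact_cball, of 0 R \<phi>] R0 by auto
  have x0: "\<phi> x \<le> sum c A" using x(2)[of 0] R0 \<phi>0 by simp
  have min: "\<phi> x \<le> \<phi> y" for y
  proof (cases "y \<in> cball 0 R")
    case False
    then have "R\<^sup>2 < (norm y)\<^sup>2" using R0 by (intro power_strict_mono) auto
    then have "2 * sum c A < e * (y \<bullet> y)"
      using e by (simp add: R2 power2_norm_eq_inner field_simps)
    then show ?thesis using x0 g0[of y] by (simp add: \<phi>_def)
  qed (rule x(2))
  \<comment> \<open>The gradient at the minimizer. Differentiating along the gradient itself gives its squared
    norm, which must be zero.\<close>
  define v where "v = (\<Sum>\<alpha>\<in>A. (c \<alpha> * exp (\<alpha> \<bullet> x)) *\<^sub>R \<alpha>) + e *\<^sub>R x"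
  have "((\<lambda>t. \<phi> (x + t *\<^sub>R v)) has_real_derivative
      (\<Sum>\<alpha>\<in>A. c \<alpha> * exp (\<alpha> \<bullet> x) * (\<alpha> \<bullet> v)) + e * (x \<bullet> v)) (at 0)"
    unfolding \<phi>_def g_def inner_add_left inner_add_right inner_scaleR_left inner_scaleR_right
    by (auto intro!: derivative_eq_intros sum.cong simp: inner_commute algebra_simps)
  then have "(\<Sum>\<alpha>\<in>A. c \<alpha> * exp (\<alpha> \<bullet> x) * (\<alpha> \<bullet> v)) + e * (x \<bullet> v) = 0"
    by (rule DERIV_local_min[where d = 1]) (auto intro: min)
  also have "(\<Sum>\<alpha>\<in>A. c \<alpha> * exp (\<alpha> \<bullet> x) * (\<alpha> \<bullet> v)) + e * (x \<bullet> v) = v \<bullet> v"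
    by (subst (3) v_def) (simp add: inner_add_left inner_sum_left)
  finally have "v = 0" by simp
  then have "(\<Sum>\<alpha>\<in>A. (c \<alpha> * exp (\<alpha> \<bullet> x)) *\<^sub>R \<alpha>) = - (e *\<^sub>R x)"
    unfolding v_def by (simp add: eq_neg_iff_add_eq_0)
  moreover have "e * (x \<bullet> x) \<le> 2 * sum c A"
    using x0 g0[of x] by (simp add: \<phi>_def)
  ultimately show ?thesis by blast
qed

text \<open>
  Duality for geometric programs. If the infimum of the exponential sum were attained, the terms at
  a minimizer, divided by their sum \<open>G\<close>, would be weights with barycenter \<open>0\<close> (vanishing gradient)
  and with \<open>\<Sum>\<alpha>. \<nu> \<alpha> * ln (c \<alpha> / \<nu> \<alpha>) = ln G\<close>, because \<open>ln (c \<alpha> / \<nu> \<alpha>) = ln G - \<alpha> \<bullet> x\<close>. In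
  general the weights come from minimizers of the sum plus a vanishing quadratic term: their
  barycenter tends to \<open>0\<close>, the quadratic term adds a nonnegative amount to \<open>ln G\<close>, and a limit point of the
  weights has the required properties since \<open>t * ln t\<close> is continuous up to \<open>0\<close>.
\<close>

lemma entropy_certificate:
  fixes A :: "'a::euclidean_space set" and c :: "'a \<Rightarrow> real"
  assumes A: "finite A" and c: "\<And>\<alpha>. \<alpha> \<in> A \<Longrightarrow> 0 \<le> c \<alpha>" and b: "0 < b"
    and bound: "\<And>x. b \<le> (\<Sum>\<alpha>\<in>A. c \<alpha> * exp (\<alpha> \<bullet> x))"
  shows "\<exists>\<nu>. (\<forall>\<alpha>\<in>A. 0 \<le> \<nu> \<alpha> \<and> (c \<alpha> = 0 \<longrightarrow> \<nu> \<alpha> = 0)) \<and> sum \<nu> A = 1 \<and>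
    (\<Sum>\<alpha>\<in>A. \<nu> \<alpha> *\<^sub>R \<alpha>) = 0 \<and> ln b \<le> (\<Sum>\<alpha>\<in>A. \<nu> \<alpha> * ln (c \<alpha>) - \<nu> \<alpha> * ln (\<nu> \<alpha>))"
proof -
  define e where "e = (\<lambda>k. inverse (real (Suc k)))"
  have e: "0 < e k" for k by (simp add: e_def)
  have e0: "e \<longlonglongrightarrow> 0" unfolding e_def by (rule LIMSEQ_inverse_real_of_nat)
  have "\<forall>k. \<exists>x. (\<Sum>\<alpha>\<in>A. (c \<alpha> * exp (\<alpha> \<bullet> x)) *\<^sub>R \<alpha>) = - (e k *\<^sub>R x) \<and>
      e k * (x \<bullet> x) \<le> 2 * sum c A"
    by (intro allI regularized_exponential_sum_critical_point A c e)
  from choice[OF this] obtain X where crit: "\<And>k. (\<Sum>\<alpha>\<in>A. (c \<alpha> * exp (\<alpha> \<bullet> X k)) *\<^sub>R \<alpha>) = - (e k *\<^sub>R X k)"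
    and X: "\<And>k. e k * (X k \<bullet> X k) \<le> 2 * sum c A"
    by blast
  define G where "G = (\<lambda>k. \<Sum>\<alpha>\<in>A. c \<alpha> * exp (\<alpha> \<bullet> X k))"
  have G: "b \<le> G k" "0 < G k" for k using bound[of "X k"] b by (auto simp: G_def)
  define \<nu> where "\<nu> = (\<lambda>k \<alpha>. c \<alpha> * exp (\<alpha> \<bullet> X k) / G k)"
  have \<nu>0: "0 \<le> \<nu> k \<alpha>" if "\<alpha> \<in> A" for k \<alpha>
    using c[OF that] G(2)[of k] by (simp add: \<nu>_def)
  have \<nu>1: "sum (\<nu> k) A = 1" for k
  proof -
    have "sum (\<nu> k) A = G k / G k"
      by (simp only: \<nu>_def sum_divide_distrib[symmetric] G_def)
    then show ?thesis using G(2)[of k] by simp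
  qed
  have box: "\<nu> k \<alpha> \<in> {0..1}" if "\<alpha> \<in> A" for k \<alpha>
    using member_le_sum[OF that, of "\<nu> k"] \<nu>0 \<nu>1 A that by simp
  have moment: "(\<Sum>\<alpha>\<in>A. \<nu> k \<alpha> *\<^sub>R \<alpha>) = - ((e k / G k) *\<^sub>R X k)" for k
  proof -
    have "(\<Sum>\<alpha>\<in>A. \<nu> k \<alpha> *\<^sub>R \<alpha>) = (1 / G k) *\<^sub>R (\<Sum>\<alpha>\<in>A. (c \<alpha> * exp (\<alpha> \<bullet> X k)) *\<^sub>R \<alpha>)"
      by (simp add: \<nu>_def scaleR_sum_right)
    then show ?thesis by (simp add: crit)
  qed
  have entropy: "ln b \<le> (\<Sum>\<alpha>\<in>A. \<nu> k \<alpha> * ln (c \<alpha>) - \<nu> k \<alpha> * ln (\<nu> k \<alpha>))" for k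
  proof -
    have "\<nu> k \<alpha> * ln (c \<alpha>) - \<nu> k \<alpha> * ln (\<nu> k \<alpha>) = \<nu> k \<alpha> * ln (G k) - (\<nu> k \<alpha> *\<^sub>R \<alpha>) \<bullet> X k"
      if "\<alpha> \<in> A" for \<alpha>
    proof (cases "c \<alpha> = 0")
      case True
      then show ?thesis by (simp add: \<nu>_def)
    next
      case False
      then have "0 < c \<alpha>" using c[OF that] by simp
      then have ln_c: "ln (c \<alpha>) = ln (\<nu> k \<alpha>) + ln (G k) - \<alpha> \<bullet> X k"
        using G(2)[of k] by (simp add: \<nu>_def ln_div ln_mult)
      show ?thesis unfolding ln_c by (simp add: algebra_simps)
    qed
    then have "(\<Sum>\<alpha>\<in>A. \<nu> k \<alpha> * ln (c \<alpha>) - \<nu> k \<alpha> * ln (\<nu> k \<alpha>))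
        = (\<Sum>\<alpha>\<in>A. \<nu> k \<alpha> * ln (G k) - (\<nu> k \<alpha> *\<^sub>R \<alpha>) \<bullet> X k)"
      by (rule sum.cong[OF refl])
    also have "\<dots> = sum (\<nu> k) A * ln (G k) - (\<Sum>\<alpha>\<in>A. \<nu> k \<alpha> *\<^sub>R \<alpha>) \<bullet> X k"
      by (simp only: sum_subtractf sum_distrib_right inner_sum_left)
    also have "\<dots> = ln (G k) + e k / G k * (X k \<bullet> X k)" by (simp add: \<nu>1 moment)
    finally show ?thesis
      using G[of k] b e[of k] ln_mono[of b "G k"] by (smt (verit) divide_nonneg_nonneg inner_ge_zero mult_nonneg_nonneg)
  qed
  have moment_0: "(\<lambda>k. (\<Sum>\<alpha>\<in>A. \<nu> k \<alpha> *\<^sub>R \<alpha>)) \<longlonglongrightarrow> 0"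
  proof (rule Lim_null_comparison)
    show "\<forall>\<^sub>F k in sequentially. norm (\<Sum>\<alpha>\<in>A. \<nu> k \<alpha> *\<^sub>R \<alpha>) \<le> sqrt (e k * (2 * sum c A)) / b"
    proof (intro always_eventually allI)
      fix k
      \<comment> \<open>\<open>e k * (X k \<bullet> X k)\<close> is bounded; the remaining factor \<open>e k\<close> yields the convergence.\<close>
      have "(e k * norm (X k))\<^sup>2 = e k * (e k * (X k \<bullet> X k))"
        by (simp add: power_mult_distrib dot_square_norm power2_eq_square algebra_simps)
      also have "\<dots> \<le> e k * (2 * sum c A)"
        using X[of k] e[of k] by (intro mult_left_mono) auto
      finally have "e k * norm (X k) \<le> sqrt (e k * (2 * sum c A))"
        by (rule real_le_rsqrt)
      moreover have "0 \<le> e k * sum c A"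
        using e[of k] by (intro mult_nonneg_nonneg sum_nonneg c) auto
      ultimately have "e k * norm (X k) / G k \<le> sqrt (e k * (2 * sum c A)) / b"
        using G[of k] b e[of k] by (intro frac_le) auto
      then show "norm (\<Sum>\<alpha>\<in>A. \<nu> k \<alpha> *\<^sub>R \<alpha>) \<le> sqrt (e k * (2 * sum c A)) / b"
        using G(2)[of k] e[of k] by (simp add: moment)
    qed
    have "(\<lambda>k. sqrt (e k * (2 * sum c A)) / b) \<longlonglongrightarrow> sqrt (0 * (2 * sum c A)) / b"
      using b by (intro tendsto_intros e0) auto
    then show "(\<lambda>k. sqrt (e k * (2 * sum c A)) / b) \<longlonglongrightarrow> 0" by simp
  qed
  obtain r l where r: "strict_mono (r :: nat \<Rightarrow> nat)"
    and l: "\<And>\<alpha>. \<alpha> \<in> A \<Longrightarrow> (\<lambda>k. \<nu> (r k) \<alpha>) \<longlonglongrightarrow> l \<alpha>"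
    using unit_box_sequence_has_convergent_subsequence[OF A, of \<nu>] box by blast
  have l0: "0 \<le> l \<alpha>" if "\<alpha> \<in> A" for \<alpha>
    using LIMSEQ_le_const[OF l[OF that]] \<nu>0[OF that] by blast
  have "l \<alpha> = 0" if "\<alpha> \<in> A" "c \<alpha> = 0" for \<alpha>
    using LIMSEQ_unique[OF l[OF that(1)], of 0] that(2) by (simp add: \<nu>_def)
  moreover have "sum l A = 1"
  proof -
    have "(\<lambda>k. sum (\<nu> (r k)) A) \<longlonglongrightarrow> sum l A" by (intro tendsto_sum l)
    then show ?thesis by (simp add: \<nu>1 LIMSEQ_const_iff)
  qed
  moreover have "(\<Sum>\<alpha>\<in>A. l \<alpha> *\<^sub>R \<alpha>) = 0"
  proof (rule LIMSEQ_unique)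
    show "(\<lambda>k. \<Sum>\<alpha>\<in>A. \<nu> (r k) \<alpha> *\<^sub>R \<alpha>) \<longlonglongrightarrow> (\<Sum>\<alpha>\<in>A. l \<alpha> *\<^sub>R \<alpha>)"
      by (intro tendsto_intros l)
    show "(\<lambda>k. \<Sum>\<alpha>\<in>A. \<nu> (r k) \<alpha> *\<^sub>R \<alpha>) \<longlonglongrightarrow> 0"
      using LIMSEQ_subseq_LIMSEQ[OF moment_0 r] by (simp add: o_def)
  qed
  moreover have "ln b \<le> (\<Sum>\<alpha>\<in>A. l \<alpha> * ln (c \<alpha>) - l \<alpha> * ln (l \<alpha>))"
  proof (rule LIMSEQ_le_const)
    have "(\<lambda>k. \<nu> (r k) \<alpha> * ln (\<nu> (r k) \<alpha>)) \<longlonglongrightarrow> l \<alpha> * ln (l \<alpha>)" if "\<alpha> \<in> A" for \<alpha>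
      using continuous_on_tendsto_compose[OF continuous_on_x_ln_x l[OF that]] l0[OF that] \<nu>0[OF that]
      by simp
    then show "(\<lambda>k. \<Sum>\<alpha>\<in>A. \<nu> (r k) \<alpha> * ln (c \<alpha>) - \<nu> (r k) \<alpha> * ln (\<nu> (r k) \<alpha>))
        \<longlonglongrightarrow> (\<Sum>\<alpha>\<in>A. l \<alpha> * ln (c \<alpha>) - l \<alpha> * ln (l \<alpha>))"
      by (intro tendsto_sum tendsto_diff tendsto_mult_right l)
    show "\<exists>N. \<forall>k\<ge>N. ln b \<le> (\<Sum>\<alpha>\<in>A. \<nu> (r k) \<alpha> * ln (c \<alpha>) - \<nu> (r k) \<alpha> * ln (\<nu> (r k) \<alpha>))"
      using entropy by blast
  qed
  ultimately show ?thesis using l0 by blast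
qed

section \<open>Cones of functions\<close>

text \<open>
  Scalar multiplication of functions is written out pointwise, so no vector space structure on the
  function type is assumed.
\<close>

definition fun_cone :: "('a \<Rightarrow> real) set \<Rightarrow> bool" where
  "fun_cone K \<longleftrightarrow> 0 \<in> K \<and> (\<forall>f\<in>K. \<forall>g\<in>K. f + g \<in> K) \<and> (\<forall>t\<ge>0. \<forall>f\<in>K. (\<lambda>x. t * f x) \<in> K)"

lemma fun_coneI:
  assumes "0 \<in> K" and "\<And>f g. f \<in> K \<Longrightarrow> g \<in> K \<Longrightarrow> f + g \<in> K"
    and "\<And>t f. 0 \<le> t \<Longrightarrow> f \<in> K \<Longrightarrow> (\<lambda>x. t * f x) \<in> K"
  shows "fun_cone K"
  using assms by (simp add: fun_cone_def)

lemma fun_cone_zero: "fun_cone K \<Longrightarrow> 0 \<in> K"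
  by (simp add: fun_cone_def)

lemma fun_cone_add: "fun_cone K \<Longrightarrow> f \<in> K \<Longrightarrow> g \<in> K \<Longrightarrow> f + g \<in> K"
  by (simp add: fun_cone_def)

lemma fun_cone_scale: "fun_cone K \<Longrightarrow> 0 \<le> t \<Longrightarrow> f \<in> K \<Longrightarrow> (\<lambda>x. t * f x) \<in> K"
  by (simp add: fun_cone_def)

lemma fun_cone_sum:
  assumes "fun_cone K" and "\<And>i. i \<in> I \<Longrightarrow> f i \<in> K"
  shows "(\<Sum>i\<in>I. f i) \<in> K"
  using assms(2)
  by (induction I rule: infinite_finite_induct) (auto intro: fun_cone_zero fun_cone_add assms(1))

lemma sum_fun_apply: "(\<Sum>i\<in>I. f i) x = (\<Sum>i\<in>I. f i x)" for f :: "'i \<Rightarrow> 'a \<Rightarrow> real"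
  by (induction I rule: infinite_finite_induct) auto

lemma fun_cone_set_plus:
  assumes "fun_cone K" and "fun_cone L"
  shows "fun_cone (K + L)"
proof (rule fun_coneI)
  show "0 \<in> K + L" using set_plus_intro[OF fun_cone_zero fun_cone_zero, OF assms] by simp
next
  fix f g assume "f \<in> K + L" "g \<in> K + L"
  then obtain a b c d where abcd: "f = a + b" "g = c + d" "a \<in> K" "b \<in> L" "c \<in> K" "d \<in> L"
    by (auto elim!: set_plus_elim)
  then have "(a + c) + (b + d) \<in> K + L" by (intro set_plus_intro fun_cone_add assms)
  then show "f + g \<in> K + L" by (simp add: abcd(1,2) algebra_simps)
next
  fix t :: real and f assume t: "0 \<le> t" and "f \<in> K + L"
  then obtain a b where ab: "f = a + b" "a \<in> K" "b \<in> L" by (auto elim!: set_plus_elim)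
  have "(\<lambda>x. t * f x) = (\<lambda>x. t * a x) + (\<lambda>x. t * b x)" by (simp add: ab(1) fun_eq_iff algebra_simps)
  then show "(\<lambda>x. t * f x) \<in> K + L" using ab t assms by (auto intro: fun_cone_scale)
qed

lemma subset_set_plus_cone:
  assumes "fun_cone L"
  shows "K \<subseteq> K + L"
proof
  fix f assume "f \<in> K"
  then have "f + 0 \<in> K + L" by (rule set_plus_intro[OF _ fun_cone_zero[OF assms]])
  then show "f \<in> K + L" by simp
qed

lemma fun_cone_set_sum:
  assumes "\<And>i. i \<in> I \<Longrightarrow> fun_cone (K i)"
  shows "fun_cone (\<Sum>i\<in>I. K i)"
  using assms
proof (induction I rule: infinite_finite_induct)
  case (insert i I)
  then show ?case by (simp add: fun_cone_set_plus)
qed (auto intro!: fun_coneI simp: fun_eq_iff)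

text \<open>
  Together with \<open>set_sum_subset_cone\<close> this characterizes a Minkowski sum of cones as the smallest
  cone containing all of them, which is how Minkowski sums are used below.
\<close>

lemma summand_subset_set_sum:
  assumes I: "finite I" "i \<in> I" and K: "\<And>j. j \<in> I \<Longrightarrow> fun_cone (K j)"
  shows "K i \<subseteq> (\<Sum>j\<in>I. K j)"
proof -
  have "K i \<subseteq> K i + (\<Sum>j\<in>I - {i}. K j)"
    using K by (intro subset_set_plus_cone fun_cone_set_sum) auto
  then show ?thesis using sum.remove[OF I, of K] by simp
qed

lemma set_sum_subset_cone:
  assumes "fun_cone K" and "\<And>i. i \<in> I \<Longrightarrow> L i \<subseteq> K"
  shows "(\<Sum>i\<in>I. L i) \<subseteq> K"
  using assms(2)
proof (induction I rule: infinite_finite_induct)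
  case (insert i I)
  then have "L i + (\<Sum>j\<in>I. L j) \<subseteq> K + K" by (intro set_plus_mono2) auto
  also have "K + K \<subseteq> K" using fun_cone_add[OF assms(1)] by (auto elim!: set_plus_elim)
  finally show ?case using insert.hyps by simp
qed (use fun_cone_zero[OF assms(1)] in auto)

section \<open>Circuits generate the AGE cones\<close>

lemma C_AGEI:
  assumes "f = (\<lambda>x. (\<Sum>\<alpha>\<in>A. c \<alpha> * expf \<alpha> x) + c \<beta> * expf \<beta> x)"
    and "\<And>\<alpha>. \<alpha> \<in> A \<Longrightarrow> 0 \<le> c \<alpha>" and "\<And>x. 0 \<le> f x"
  shows "f \<in> C_AGE A \<beta>"
  unfolding C_AGE_def using assms by blast

lemma C_AGEE:
  assumes "f \<in> C_AGE A \<beta>"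
  obtains c where "f = (\<lambda>x. (\<Sum>\<alpha>\<in>A. c \<alpha> * expf \<alpha> x) + c \<beta> * expf \<beta> x)"
    and "\<And>\<alpha>. \<alpha> \<in> A \<Longrightarrow> 0 \<le> c \<alpha>" and "\<And>x. 0 \<le> f x"
  using assms unfolding C_AGE_def by blast

lemma fun_cone_C_AGE: "fun_cone (C_AGE A \<beta>)"
proof (rule fun_coneI)
  show "0 \<in> C_AGE A \<beta>"
    by (rule C_AGEI[where c = "\<lambda>_. 0"]) (simp_all add: fun_eq_iff)
next
  fix f g assume "f \<in> C_AGE A \<beta>" "g \<in> C_AGE A \<beta>"
  then obtain c d
    where c: "f = (\<lambda>x. (\<Sum>\<alpha>\<in>A. c \<alpha> * expf \<alpha> x) + c \<beta> * expf \<beta> x)"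
        "\<And>\<alpha>. \<alpha> \<in> A \<Longrightarrow> 0 \<le> c \<alpha>" "\<And>x. 0 \<le> f x"
      and d: "g = (\<lambda>x. (\<Sum>\<alpha>\<in>A. d \<alpha> * expf \<alpha> x) + d \<beta> * expf \<beta> x)"
        "\<And>\<alpha>. \<alpha> \<in> A \<Longrightarrow> 0 \<le> d \<alpha>" "\<And>x. 0 \<le> g x"
    by (elim C_AGEE) blast
  show "f + g \<in> C_AGE A \<beta>"
  proof (rule C_AGEI[where c = "\<lambda>\<alpha>. c \<alpha> + d \<alpha>"])
    show "f + g = (\<lambda>x. (\<Sum>\<alpha>\<in>A. (c \<alpha> + d \<alpha>) * expf \<alpha> x) + (c \<beta> + d \<beta>) * expf \<beta> x)"
      by (simp add: c(1) d(1) fun_eq_iff sum.distrib algebra_simps)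
  qed (simp_all add: c(2,3) d(2,3))
next
  fix t :: real and f assume t: "0 \<le> t" and "f \<in> C_AGE A \<beta>"
  then obtain c where c: "f = (\<lambda>x. (\<Sum>\<alpha>\<in>A. c \<alpha> * expf \<alpha> x) + c \<beta> * expf \<beta> x)"
      "\<And>\<alpha>. \<alpha> \<in> A \<Longrightarrow> 0 \<le> c \<alpha>" "\<And>x. 0 \<le> f x"
    by (elim C_AGEE) blast
  show "(\<lambda>x. t * f x) \<in> C_AGE A \<beta>"
  proof (rule C_AGEI[where c = "\<lambda>\<alpha>. t * c \<alpha>"])
    show "(\<lambda>x. t * f x) = (\<lambda>x. (\<Sum>\<alpha>\<in>A. t * c \<alpha> * expf \<alpha> x) + t * c \<beta> * expf \<beta> x)"
      by (simp add: c(1) fun_eq_iff sum_distrib_left algebra_simps)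
  qed (simp_all add: c(2,3) t)
qed

lemma C_AGE_mono:
  assumes "finite B" and AB: "A \<subseteq> B" and \<beta>: "\<beta> \<notin> B"
  shows "C_AGE A \<beta> \<subseteq> C_AGE B \<beta>"
proof
  fix f assume "f \<in> C_AGE A \<beta>"
  then obtain c where c: "f = (\<lambda>x. (\<Sum>\<alpha>\<in>A. c \<alpha> * expf \<alpha> x) + c \<beta> * expf \<beta> x)"
      "\<And>\<alpha>. \<alpha> \<in> A \<Longrightarrow> 0 \<le> c \<alpha>" "\<And>x. 0 \<le> f x"
    by (elim C_AGEE) blast
  let ?d = "\<lambda>\<alpha>. if \<alpha> \<in> insert \<beta> A then c \<alpha> else 0"
  have "(\<Sum>\<alpha>\<in>A. c \<alpha> * expf \<alpha> x) = (\<Sum>\<alpha>\<in>B. ?d \<alpha> * expf \<alpha> x)" for x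
    using \<beta> by (intro sum.mono_neutral_cong_left assms) auto
  then have "f = (\<lambda>x. (\<Sum>\<alpha>\<in>B. ?d \<alpha> * expf \<alpha> x) + ?d \<beta> * expf \<beta> x)" by (simp add: c(1))
  then show "f \<in> C_AGE B \<beta>" by (rule C_AGEI) (use c(2,3) \<beta> in auto)
qed

lemma expf_in_C_AGE:
  assumes "\<beta> \<notin> A"
  shows "expf \<beta> \<in> C_AGE A \<beta>"
proof (rule C_AGEI[where c = "\<lambda>\<alpha>. if \<alpha> = \<beta> then 1 else 0"])
  have "(\<Sum>\<alpha>\<in>A. (if \<alpha> = \<beta> then 1 else 0) * expf \<alpha> x) = 0" for x
    using assms by (intro sum.neutral) auto
  then show "expf \<beta> = (\<lambda>x. (\<Sum>\<alpha>\<in>A. (if \<alpha> = \<beta> then 1 else 0) * expf \<alpha> x) + (if \<beta> = \<beta> then 1 else 0) * expf \<beta> x)"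
    by simp
qed (simp_all add: expf_def)

lemma sum_zero_has_negative:
  fixes u :: "'a \<Rightarrow> real"
  assumes P: "finite P" and "sum u P = 0" and nz: "\<exists>\<alpha>\<in>P. u \<alpha> \<noteq> 0"
  shows "\<exists>\<alpha>\<in>P. u \<alpha> < 0"
proof (rule ccontr)
  assume "\<not> (\<exists>\<alpha>\<in>P. u \<alpha> < 0)"
  then have "\<And>\<alpha>. \<alpha> \<in> P \<Longrightarrow> 0 \<le> u \<alpha>" by (simp add: not_less)
  from sum_nonneg_eq_0_iff[OF P this] have "\<forall>\<alpha>\<in>P. u \<alpha> = 0" using \<open>sum u P = 0\<close> by simp
  then show False using nz by blast
qed

text \<open>
  The ratio test of the simplex method: take for \<open>s\<close> the first time at which a coordinate reaches zero.
\<close>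

lemma move_until_coordinate_vanishes:
  fixes w u :: "'a \<Rightarrow> real"
  assumes P: "finite P" and pos: "\<And>\<alpha>. \<alpha> \<in> P \<Longrightarrow> 0 < w \<alpha>"
    and u: "\<alpha>\<^sub>0 \<in> P" "u \<alpha>\<^sub>0 < 0"
  shows "\<exists>s>0. (\<forall>\<alpha>\<in>P. 0 \<le> w \<alpha> + s * u \<alpha>) \<and> (\<exists>\<alpha>\<in>P. w \<alpha> + s * u \<alpha> = 0)"
proof -
  define N where "N = {\<alpha>\<in>P. u \<alpha> < 0}"
  have N: "finite N" "N \<noteq> {}" using P u by (auto simp: N_def)
  define s where "s = Min ((\<lambda>\<alpha>. w \<alpha> / - u \<alpha>) ` N)"
  have "s \<in> (\<lambda>\<alpha>. w \<alpha> / - u \<alpha>) ` N" unfolding s_def using N by (intro Min_in) auto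
  then obtain \<alpha> where \<alpha>: "\<alpha> \<in> N" and s: "s = w \<alpha> / - u \<alpha>" by blast
  have s0: "0 < s" using \<alpha> pos unfolding s N_def by (intro divide_pos_pos) auto
  have "0 \<le> w \<gamma> + s * u \<gamma>" if "\<gamma> \<in> P" for \<gamma>
  proof (cases "u \<gamma> < 0")
    case True
    then have "s \<le> w \<gamma> / - u \<gamma>" unfolding s_def using N that by (intro Min_le) (auto simp: N_def)
    then show ?thesis using True by (simp add: field_simps)
  next
    case False
    then show ?thesis using s0 pos[OF that] by (simp add: add_nonneg_nonneg)
  qed
  moreover have "w \<alpha> + s * u \<alpha> = 0" using \<alpha> by (simp add: s N_def)
  ultimately show ?thesis using s0 \<alpha> unfolding N_def by blast
qed

text \<open>
  For weights \<open>w\<close> with barycenter \<open>\<beta>\<close>, the sum of the tangent line inequalities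
  \<open>exp u \<ge> 1 + u\<close> at \<open>u = ln (r \<alpha>) + (\<alpha> - \<beta>) \<bullet> x\<close>, weighted by \<open>w \<alpha>\<close> and multiplied by
  \<open>exp (\<beta> \<bullet> x)\<close>. Unlike the sharper inequality between weighted means, it depends affinely on the
  weights, so that splitting the weights splits the signomial.
\<close>

definition tangent_signomial ::
    "(real ^ 'n) set \<Rightarrow> real ^ 'n \<Rightarrow> (real ^ 'n \<Rightarrow> real) \<Rightarrow> (real ^ 'n \<Rightarrow> real) \<Rightarrow> 'n::finite signomial" where
  "tangent_signomial S \<beta> r w =
    (\<lambda>x. (\<Sum>\<alpha>\<in>S. w \<alpha> * r \<alpha> * expf \<alpha> x) - (1 + (\<Sum>\<alpha>\<in>S. w \<alpha> * ln (r \<alpha>))) * expf \<beta> x)"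

lemma tangent_signomial_nonneg:
  assumes r: "\<And>\<alpha>. \<alpha> \<in> S \<Longrightarrow> 0 < r \<alpha>" and nonneg: "\<And>\<alpha>. \<alpha> \<in> S \<Longrightarrow> 0 \<le> w \<alpha>"
    and sum1: "sum w S = 1" and bary: "(\<Sum>\<alpha>\<in>S. w \<alpha> *\<^sub>R \<alpha>) = \<beta>"
  shows "0 \<le> tangent_signomial S \<beta> r w x"
proof -
  have "(1 + ln (r \<alpha>) + (\<alpha> \<bullet> x - \<beta> \<bullet> x)) * expf \<beta> x \<le> r \<alpha> * expf \<alpha> x" if "\<alpha> \<in> S" for \<alpha>
  proof -
    have "1 + (ln (r \<alpha>) + (\<alpha> \<bullet> x - \<beta> \<bullet> x)) \<le> exp (ln (r \<alpha>) + (\<alpha> \<bullet> x - \<beta> \<bullet> x))"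
      by (rule exp_ge_add_one_self)
    then have "(1 + ln (r \<alpha>) + (\<alpha> \<bullet> x - \<beta> \<bullet> x)) * exp (\<beta> \<bullet> x)
        \<le> exp (ln (r \<alpha>) + (\<alpha> \<bullet> x - \<beta> \<bullet> x)) * exp (\<beta> \<bullet> x)"
      by (intro mult_right_mono) (auto simp: add.assoc)
    also have "\<dots> = r \<alpha> * exp (\<alpha> \<bullet> x)" using r[OF that] by (simp add: exp_add exp_diff)
    finally show ?thesis by (simp add: expf_def)
  qed
  then have "(\<Sum>\<alpha>\<in>S. w \<alpha> * ((1 + ln (r \<alpha>) + (\<alpha> \<bullet> x - \<beta> \<bullet> x)) * expf \<beta> x))
      \<le> (\<Sum>\<alpha>\<in>S. w \<alpha> * (r \<alpha> * expf \<alpha> x))"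
    by (intro sum_mono mult_left_mono nonneg)
  moreover have "(\<Sum>\<alpha>\<in>S. w \<alpha> * ((1 + ln (r \<alpha>) + (\<alpha> \<bullet> x - \<beta> \<bullet> x)) * expf \<beta> x))
      = (sum w S + (\<Sum>\<alpha>\<in>S. w \<alpha> * ln (r \<alpha>)) + ((\<Sum>\<alpha>\<in>S. w \<alpha> *\<^sub>R \<alpha>) \<bullet> x - sum w S * (\<beta> \<bullet> x))) * expf \<beta> x"
    by (simp add: sum.distrib sum_subtractf sum_distrib_left sum_distrib_right inner_sum_left algebra_simps)
  ultimately show ?thesis by (simp add: tangent_signomial_def sum1 bary mult.assoc)
qed

lemma normalized_circuit_of_barycenter:
  fixes w :: "real ^ 'n::finite \<Rightarrow> real"
  assumes T: "finite T" and \<beta>: "\<beta> \<in> T" "\<beta> \<notin> P" and PT: "P \<subseteq> T"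
    and pos: "\<And>\<alpha>. \<alpha> \<in> P \<Longrightarrow> 0 < w \<alpha>" and ind: "\<not> affine_dependent P"
    and sum1: "sum w P = 1" and bary: "(\<Sum>\<alpha>\<in>P. w \<alpha> *\<^sub>R \<alpha>) = \<beta>"
  defines "\<nu> \<equiv> \<lambda>\<alpha>. if \<alpha> = \<beta> then -1 else if \<alpha> \<in> P then w \<alpha> else 0"
  shows "\<nu> \<in> normalized_circuits T" "circuit_neg \<nu> = \<beta>" "circuit_pos \<nu> = P"
proof -
  have neg_iff: "\<nu> \<alpha> < 0 \<longleftrightarrow> \<alpha> = \<beta>" for \<alpha>
    using pos[of \<alpha>] by (auto simp: \<nu>_def)
  then show neg: "circuit_neg \<nu> = \<beta>" by (simp add: circuit_neg_def)
  show cpos: "circuit_pos \<nu> = P"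
    using pos \<beta> by (auto simp: circuit_pos_def \<nu>_def split: if_splits)
  have on_P: "\<nu> \<alpha> = w \<alpha>" if "\<alpha> \<in> P" for \<alpha> using that \<beta> by (auto simp: \<nu>_def)
  have sumP: "sum \<nu> P = 1" using sum1 on_P by simp
  have "sum \<nu> T = sum \<nu> (insert \<beta> P)"
    using T \<beta> PT by (intro sum.mono_neutral_right) (auto simp: \<nu>_def)
  also have "\<dots> = 0" using sumP \<beta> finite_subset[OF PT T] by (simp add: \<nu>_def)
  finally have "sum \<nu> T = 0" .
  moreover have "(\<Sum>\<alpha>\<in>P. \<nu> \<alpha> *\<^sub>R \<alpha>) = \<beta>" using bary on_P by simp
  moreover have "\<forall>\<alpha>. \<alpha> \<notin> T \<longrightarrow> \<nu> \<alpha> = 0" using \<beta> PT by (auto simp: \<nu>_def)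
  moreover have "\<exists>\<alpha>. \<nu> \<alpha> \<noteq> 0" "\<exists>!\<alpha>. \<nu> \<alpha> < 0" by (auto simp: neg_iff intro!: exI[of _ \<beta>], simp add: \<nu>_def)
  ultimately show "\<nu> \<in> normalized_circuits T"
    using sumP ind by (simp add: normalized_circuits_def simplicial_circuit_def neg cpos)
qed

text \<open>
  The weights representing \<open>\<beta>\<close> form a polytope whose vertices have affinely independent support,
  that is, are normalized circuits. Weights with affinely dependent support are moved along an affine
  dependence in both directions until a coordinate vanishes; this exhibits them, and by affinity their
  tangent signomials, as convex combinations of two with smaller support.
\<close>

lemma tangent_signomial_in_circuit_cone:
  fixes T S :: "(real ^ 'n::finite) set"
  assumes T: "finite T" and \<beta>: "\<beta> \<in> T" "\<beta> \<notin> S" and ST: "S \<subseteq> T" and K: "fun_cone K"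
    and circuits: "\<And>\<nu>. \<nu> \<in> normalized_circuits T \<Longrightarrow> circuit_neg \<nu> = \<beta> \<Longrightarrow> C_AGE (circuit_pos \<nu>) \<beta> \<subseteq> K"
    and r: "\<And>\<alpha>. \<alpha> \<in> S \<Longrightarrow> 0 < r \<alpha>"
    and "\<And>\<alpha>. \<alpha> \<in> S \<Longrightarrow> 0 \<le> w \<alpha>" "sum w S = 1" "(\<Sum>\<alpha>\<in>S. w \<alpha> *\<^sub>R \<alpha>) = \<beta>"
  shows "tangent_signomial S \<beta> r w \<in> K"
  using assms(8-)
proof (induction "card {\<alpha>\<in>S. w \<alpha> \<noteq> 0}" arbitrary: w rule: less_induct)
  case less
  note nonneg = less.prems(1) and sum1 = less.prems(2) and bary = less.prems(3)
  have S: "finite S" using T ST by (rule finite_subset[rotated])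
  define P where "P = {\<alpha>\<in>S. w \<alpha> \<noteq> 0}"
  have P: "finite P" "P \<subseteq> S" using S by (auto simp: P_def)
  have pos: "0 < w \<alpha>" if "\<alpha> \<in> P" for \<alpha> using nonneg[of \<alpha>] that by (simp add: P_def)
  have restrict: "(\<Sum>\<alpha>\<in>S. h \<alpha>) = (\<Sum>\<alpha>\<in>P. h \<alpha>)" if "\<And>\<alpha>. w \<alpha> = 0 \<Longrightarrow> h \<alpha> = 0"
    for h :: "real ^ 'n \<Rightarrow> 'b::comm_monoid_add"
    using S that by (intro sum.mono_neutral_right) (auto simp: P_def)
  show ?case
  proof (cases "affine_dependent P")
    case False
    have \<beta>P: "\<beta> \<notin> P" and PT: "P \<subseteq> T" using \<beta> P ST by auto
    have "sum w P = 1" "(\<Sum>\<alpha>\<in>P. w \<alpha> *\<^sub>R \<alpha>) = \<beta>" using sum1 bary restrict by (metis, metis (no_types, lifting) scale_eq_0_iff)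
    from normalized_circuit_of_barycenter[OF T \<beta>(1) \<beta>P PT pos False this]
    have "C_AGE P \<beta> \<subseteq> K" using circuits by metis
    moreover have "tangent_signomial S \<beta> r w \<in> C_AGE P \<beta>"
    proof -
      let ?c = "\<lambda>\<alpha>. if \<alpha> = \<beta> then - (1 + (\<Sum>\<alpha>\<in>S. w \<alpha> * ln (r \<alpha>))) else w \<alpha> * r \<alpha>"
      have "(\<Sum>\<alpha>\<in>S. w \<alpha> * r \<alpha> * expf \<alpha> x) = (\<Sum>\<alpha>\<in>P. ?c \<alpha> * expf \<alpha> x)" for x
        using \<beta>P by (subst restrict) (auto intro!: sum.cong)
      then have "tangent_signomial S \<beta> r w = (\<lambda>x. (\<Sum>\<alpha>\<in>P. ?c \<alpha> * expf \<alpha> x) + ?c \<beta> * expf \<beta> x)"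
        by (simp add: tangent_signomial_def fun_eq_iff algebra_simps)
      then show ?thesis
      proof (rule C_AGEI)
        show "0 \<le> ?c \<alpha>" if "\<alpha> \<in> P" for \<alpha>
          using that \<beta>P pos[OF that] r[of \<alpha>] P by auto
        show "0 \<le> tangent_signomial S \<beta> r w x" for x
          using r nonneg sum1 bary by (rule tangent_signomial_nonneg)
      qed
    qed
    ultimately show ?thesis by blast
  next
    case True
    then obtain v where v: "sum v P = 0" "(\<Sum>\<alpha>\<in>P. v \<alpha> *\<^sub>R \<alpha>) = 0" "\<exists>\<alpha>\<in>P. v \<alpha> \<noteq> 0"
      unfolding affine_dependent_explicit_finite[OF P(1)] by blast
    define u where "u = (\<lambda>\<alpha>. if \<alpha> \<in> P then v \<alpha> else 0)"
    have outside: "u \<alpha> = 0" if "w \<alpha> = 0" for \<alpha> using that by (simp add: u_def P_def)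
    have u: "sum u S = 0" "(\<Sum>\<alpha>\<in>S. u \<alpha> *\<^sub>R \<alpha>) = 0"
      using v by (simp_all add: restrict outside) (simp_all add: u_def)
    have uP: "sum u P = 0" "\<exists>\<alpha>\<in>P. u \<alpha> \<noteq> 0" using v by (simp_all add: u_def)
    obtain s where s: "0 < s" "\<forall>\<alpha>\<in>P. 0 \<le> w \<alpha> + s * u \<alpha>" "\<exists>\<alpha>\<in>P. w \<alpha> + s * u \<alpha> = 0"
      using sum_zero_has_negative[OF P(1) uP] move_until_coordinate_vanishes[of P w _ u] P(1) pos by blast
    have "\<exists>\<alpha>\<in>P. - u \<alpha> < 0"
      using sum_zero_has_negative[OF P(1), of "\<lambda>\<alpha>. - u \<alpha>"] uP by (simp add: sum_negf)
    then obtain t where t: "0 < t" "\<forall>\<alpha>\<in>P. 0 \<le> w \<alpha> + t * - u \<alpha>" "\<exists>\<alpha>\<in>P. w \<alpha> + t * - u \<alpha> = 0"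
      using move_until_coordinate_vanishes[of P w _ "\<lambda>\<alpha>. - u \<alpha>"] P(1) pos by blast
    have step: "tangent_signomial S \<beta> r (\<lambda>\<alpha>. w \<alpha> + q * u \<alpha>) \<in> K"
      if q: "\<forall>\<alpha>\<in>P. 0 \<le> w \<alpha> + q * u \<alpha>" "\<exists>\<alpha>\<in>P. w \<alpha> + q * u \<alpha> = 0" for q
    proof (rule less.hyps)
      have "{\<alpha>\<in>S. w \<alpha> + q * u \<alpha> \<noteq> 0} \<subset> P" using q(2) P outside by (auto simp: P_def)
      then show "card {\<alpha>\<in>S. w \<alpha> + q * u \<alpha> \<noteq> 0} < card {\<alpha>\<in>S. w \<alpha> \<noteq> 0}"
        unfolding P_def[symmetric] by (rule psubset_card_mono[OF P(1)])
      show "0 \<le> w \<alpha> + q * u \<alpha>" if "\<alpha> \<in> S" for \<alpha>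
        using q(1) outside that by (cases "\<alpha> \<in> P") (auto simp: P_def)
      show "(\<Sum>\<alpha>\<in>S. w \<alpha> + q * u \<alpha>) = 1"
        using sum1 u(1) by (simp add: sum.distrib sum_distrib_left[symmetric])
      show "(\<Sum>\<alpha>\<in>S. (w \<alpha> + q * u \<alpha>) *\<^sub>R \<alpha>) = \<beta>"
        using bary u(2) by (simp add: scaleR_add_left sum.distrib scaleR_scaleR[symmetric]
            scaleR_sum_right[symmetric] del: scaleR_scaleR)
    qed
    have affine: "tangent_signomial S \<beta> r (\<lambda>\<alpha>. w \<alpha> + q * u \<alpha>) x = tangent_signomial S \<beta> r w x
        + q * ((\<Sum>\<alpha>\<in>S. u \<alpha> * r \<alpha> * expf \<alpha> x) - (\<Sum>\<alpha>\<in>S. u \<alpha> * ln (r \<alpha>)) * expf \<beta> x)" for q x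
      by (simp add: tangent_signomial_def sum.distrib sum_distrib_left algebra_simps)
    \<comment> \<open>The point reached after moving by \<open>s\<close> gets the weight \<open>t / (s + t)\<close>, and conversely, so that the
      displacements \<open>s * u\<close> and \<open>- t * u\<close> cancel.\<close>
    let ?h = "(\<lambda>x. t / (s + t) * tangent_signomial S \<beta> r (\<lambda>\<alpha>. w \<alpha> + s * u \<alpha>) x)
        + (\<lambda>x. s / (s + t) * tangent_signomial S \<beta> r (\<lambda>\<alpha>. w \<alpha> + (- t) * u \<alpha>) x)"
    have "?h \<in> K"
      using s t by (intro fun_cone_add[OF K] fun_cone_scale[OF K] step) auto
    moreover have "?h = tangent_signomial S \<beta> r w"
      unfolding affine fun_eq_iff using s(1) t(1) by (simp add: divide_simps) (simp add: algebra_simps)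
    ultimately show ?thesis by simp
  qed
qed

text \<open>
  The decomposition of AGE cones before symmetrization. If the coefficient \<open>- b\<close> at \<open>\<beta>\<close> is negative, the entropy
  certificate gives weights \<open>w\<close> on the other exponents with barycenter \<open>\<beta>\<close>. With
  \<open>r \<alpha> = c \<alpha> / (b * w \<alpha>)\<close> the multiple \<open>b\<close> of the tangent signomial has the coefficients \<open>c \<alpha>\<close> on
  the support of \<open>w\<close> and, by the entropy bound, a coefficient at most \<open>- b\<close> at \<open>\<beta>\<close>. What is missing
  to the given signomial is a nonnegative combination of exponentials.
\<close>

lemma C_AGE_subset_circuit_cone:
  fixes T :: "(real ^ 'n::finite) set"
  assumes T: "finite T" and \<beta>: "\<beta> \<in> T" and K: "fun_cone K"
    and circuits: "\<And>\<nu>. \<nu> \<in> normalized_circuits T \<Longrightarrow> circuit_neg \<nu> = \<beta> \<Longrightarrow> C_AGE (circuit_pos \<nu>) \<beta> \<subseteq> K"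
    and exps: "\<And>\<alpha>. \<alpha> \<in> T \<Longrightarrow> expf \<alpha> \<in> K"
  shows "C_AGE (T - {\<beta>}) \<beta> \<subseteq> K"
proof
  fix f assume "f \<in> C_AGE (T - {\<beta>}) \<beta>"
  define A where "A = T - {\<beta>}"
  have A: "finite A" using T by (simp add: A_def)
  obtain c where c: "\<And>\<alpha>. \<alpha> \<in> A \<Longrightarrow> 0 \<le> c \<alpha>" and f0: "\<And>x. 0 \<le> f x"
    and f: "f = (\<lambda>x. (\<Sum>\<alpha>\<in>A. c \<alpha> * expf \<alpha> x) + c \<beta> * expf \<beta> x)"
    using \<open>f \<in> _\<close> unfolding A_def by (elim C_AGEE) blast
  have exps_sum: "(\<lambda>x. \<Sum>\<alpha>\<in>U. d \<alpha> * expf \<alpha> x) \<in> K"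
    if "U \<subseteq> T" "\<And>\<alpha>. \<alpha> \<in> U \<Longrightarrow> 0 \<le> d \<alpha>" for U d
  proof -
    have "(\<Sum>\<alpha>\<in>U. (\<lambda>x. d \<alpha> * expf \<alpha> x)) \<in> K"
      using that by (intro fun_cone_sum[OF K] fun_cone_scale[OF K] exps) auto
    moreover have "(\<Sum>\<alpha>\<in>U. (\<lambda>x. d \<alpha> * expf \<alpha> x)) = (\<lambda>x. \<Sum>\<alpha>\<in>U. d \<alpha> * expf \<alpha> x)"
      by (simp add: fun_eq_iff sum_fun_apply)
    ultimately show ?thesis by simp
  qed
  show "f \<in> K"
  proof (cases "0 \<le> c \<beta>")
    case True
    have "f = (\<lambda>x. \<Sum>\<alpha>\<in>T. c \<alpha> * expf \<alpha> x)"
      by (simp add: f A_def sum.remove[OF T \<beta>] add.commute)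
    moreover have "0 \<le> c \<alpha>" if "\<alpha> \<in> T" for \<alpha> using c that True by (cases "\<alpha> = \<beta>") (auto simp: A_def)
    ultimately show ?thesis using exps_sum[of T c] by simp
  next
    case False
    define b where "b = - c \<beta>"
    have b: "0 < b" using False by (simp add: b_def)
    \<comment> \<open>Dividing by \<open>exp (\<beta> \<bullet> x)\<close> turns nonnegativity into a constant lower bound for an exponential sum.\<close>
    define B where "B = (\<lambda>\<alpha>. \<alpha> - \<beta>) ` A"
    have inj: "inj_on (\<lambda>\<alpha>. \<alpha> - \<beta>) A" by (auto simp: inj_on_def)
    have "b \<le> (\<Sum>\<gamma>\<in>B. c (\<gamma> + \<beta>) * exp (\<gamma> \<bullet> x))" for x
    proof -
      have "b * exp (\<beta> \<bullet> x) \<le> (\<Sum>\<alpha>\<in>A. c \<alpha> * exp (\<alpha> \<bullet> x))"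
        using f0[of x] by (simp add: f b_def expf_def)
      then have "b \<le> (\<Sum>\<alpha>\<in>A. c \<alpha> * exp (\<alpha> \<bullet> x)) / exp (\<beta> \<bullet> x)" by (simp add: field_simps)
      also have "\<dots> = (\<Sum>\<gamma>\<in>B. c (\<gamma> + \<beta>) * exp (\<gamma> \<bullet> x))"
        unfolding B_def by (simp add: sum.reindex[OF inj] sum_divide_distrib inner_diff_left exp_diff)
      finally show ?thesis .
    qed
    then obtain \<mu> where \<mu>: "\<And>\<gamma>. \<gamma> \<in> B \<Longrightarrow> 0 \<le> \<mu> \<gamma> \<and> (c (\<gamma> + \<beta>) = 0 \<longrightarrow> \<mu> \<gamma> = 0)"
        "sum \<mu> B = 1" "(\<Sum>\<gamma>\<in>B. \<mu> \<gamma> *\<^sub>R \<gamma>) = 0"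
        "ln b \<le> (\<Sum>\<gamma>\<in>B. \<mu> \<gamma> * ln (c (\<gamma> + \<beta>)) - \<mu> \<gamma> * ln (\<mu> \<gamma>))"
      using entropy_certificate[of B "\<lambda>\<gamma>. c (\<gamma> + \<beta>)" b] A b c unfolding B_def by fastforce
    define w where "w = (\<lambda>\<alpha>. \<mu> (\<alpha> - \<beta>))"
    have w0: "0 \<le> w \<alpha>" "c \<alpha> = 0 \<Longrightarrow> w \<alpha> = 0" if "\<alpha> \<in> A" for \<alpha>
      using \<mu>(1)[of "\<alpha> - \<beta>"] that by (auto simp: w_def B_def)
    have w1: "sum w A = 1"
      using \<mu>(2) by (simp add: B_def sum.reindex[OF inj] w_def o_def)
    have "(\<Sum>\<alpha>\<in>A. w \<alpha> *\<^sub>R \<alpha>) - sum w A *\<^sub>R \<beta> = 0"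
      using \<mu>(3) by (simp add: B_def sum.reindex[OF inj] w_def o_def scaleR_diff_right sum_subtractf scaleR_sum_left)
    then have bary: "(\<Sum>\<alpha>\<in>A. w \<alpha> *\<^sub>R \<alpha>) = \<beta>" using w1 by simp
    have ent: "ln b \<le> (\<Sum>\<alpha>\<in>A. w \<alpha> * ln (c \<alpha>) - w \<alpha> * ln (w \<alpha>))"
      using \<mu>(4) by (simp add: B_def sum.reindex[OF inj] w_def o_def)
    define S where "S = {\<alpha>\<in>A. w \<alpha> \<noteq> 0}"
    have SA: "S \<subseteq> A" by (auto simp: S_def)
    have restrict: "(\<Sum>\<alpha>\<in>A. h \<alpha>) = (\<Sum>\<alpha>\<in>S. h \<alpha>)" if "\<And>\<alpha>. w \<alpha> = 0 \<Longrightarrow> h \<alpha> = 0"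
      for h :: "real ^ 'n \<Rightarrow> 'b::comm_monoid_add"
      using A that by (intro sum.mono_neutral_right) (auto simp: S_def)
    have pos: "0 < w \<alpha>" "0 < c \<alpha>" if "\<alpha> \<in> S" for \<alpha>
      using w0[of \<alpha>] c[of \<alpha>] that by (auto simp: S_def less_le)
    define r where "r = (\<lambda>\<alpha>. c \<alpha> / (b * w \<alpha>))"
    define F where "F = tangent_signomial S \<beta> r w"
    define \<delta> where "\<delta> = (\<Sum>\<alpha>\<in>S. w \<alpha> * ln (r \<alpha>))"
    have S1: "sum w S = 1" using w1 restrict by metis
    have Sbary: "(\<Sum>\<alpha>\<in>S. w \<alpha> *\<^sub>R \<alpha>) = \<beta>" using bary by (subst (asm) restrict) auto
    have FK: "F \<in> K"
      unfolding F_def using T \<beta> _ _ K circuits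
    proof (rule tangent_signomial_in_circuit_cone)
      show "\<beta> \<notin> S" "S \<subseteq> T" using SA by (auto simp: A_def)
      show "0 < r \<alpha>" "0 \<le> w \<alpha>" if "\<alpha> \<in> S" for \<alpha> using pos[OF that] b by (auto simp: r_def)
    qed (use S1 Sbary in auto)
    have "0 \<le> \<delta>"
    proof -
      have "w \<alpha> * ln (r \<alpha>) = w \<alpha> * ln (c \<alpha>) - w \<alpha> * ln (w \<alpha>) - w \<alpha> * ln b" if "\<alpha> \<in> S" for \<alpha>
        using pos[OF that] b by (simp add: r_def ln_div ln_mult algebra_simps)
      then have "\<delta> = (\<Sum>\<alpha>\<in>S. w \<alpha> * ln (c \<alpha>) - w \<alpha> * ln (w \<alpha>) - w \<alpha> * ln b)"
        by (simp add: \<delta>_def)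
      also have "\<dots> = (\<Sum>\<alpha>\<in>S. w \<alpha> * ln (c \<alpha>) - w \<alpha> * ln (w \<alpha>)) - sum w S * ln b"
        by (simp add: sum_subtractf sum_distrib_right)
      also have "(\<Sum>\<alpha>\<in>S. w \<alpha> * ln (c \<alpha>) - w \<alpha> * ln (w \<alpha>)) = (\<Sum>\<alpha>\<in>A. w \<alpha> * ln (c \<alpha>) - w \<alpha> * ln (w \<alpha>))"
        by (rule restrict[symmetric]) simp
      finally show ?thesis using ent S1 by simp
    qed
    have "f = (\<lambda>x. b * F x) + (\<lambda>x. \<Sum>\<alpha>\<in>{\<beta>}. b * \<delta> * expf \<alpha> x) + (\<lambda>x. \<Sum>\<alpha>\<in>A - S. c \<alpha> * expf \<alpha> x)"
    proof
      fix x
      have "b * F x = (\<Sum>\<alpha>\<in>S. b * (w \<alpha> * r \<alpha> * expf \<alpha> x)) - b * expf \<beta> x - b * \<delta> * expf \<beta> x"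
        unfolding F_def tangent_signomial_def \<delta>_def[symmetric] by (simp add: algebra_simps sum_distrib_left)
      also have "(\<Sum>\<alpha>\<in>S. b * (w \<alpha> * r \<alpha> * expf \<alpha> x)) = (\<Sum>\<alpha>\<in>S. c \<alpha> * expf \<alpha> x)"
      proof (intro sum.cong refl)
        fix \<alpha> assume "\<alpha> \<in> S"
        from pos[OF this] b show "b * (w \<alpha> * r \<alpha> * expf \<alpha> x) = c \<alpha> * expf \<alpha> x"
          by (simp add: r_def)
      qed
      finally show "f x = ((\<lambda>x. b * F x) + (\<lambda>x. \<Sum>\<alpha>\<in>{\<beta>}. b * \<delta> * expf \<alpha> x) + (\<lambda>x. \<Sum>\<alpha>\<in>A - S. c \<alpha> * expf \<alpha> x)) x"
        by (simp add: f b_def sum.subset_diff[OF SA A])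
    qed
    also have "\<dots> \<in> K"
      using \<open>0 \<le> \<delta>\<close> b \<beta> c by (intro fun_cone_add[OF K] fun_cone_scale[OF K] FK exps_sum) (auto simp: A_def)
    finally show ?thesis .
  qed
qed

section \<open>Symmetrization\<close>

lemma id_in_Sym: "id \<in> Sym"
  by (simp add: Sym_def permutes_def)

lemma comp_in_Sym: "\<rho> \<in> Sym \<Longrightarrow> \<sigma> \<in> Sym \<Longrightarrow> \<rho> \<circ> \<sigma> \<in> Sym"
  by (simp add: Sym_def permutes_compose)

lemma inv_in_Sym: "\<rho> \<in> Sym \<Longrightarrow> inv \<rho> \<in> Sym"
  by (simp add: Sym_def permutes_inv)

lemma bij_if_in_Sym: "\<rho> \<in> Sym \<Longrightarrow> bij \<rho>"
  by (simp add: Sym_def permutes_bij)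

lemma inv_comp_Sym: "\<rho> \<in> Sym \<Longrightarrow> inv \<rho> \<circ> \<rho> = id" "\<rho> \<in> Sym \<Longrightarrow> \<rho> \<circ> inv \<rho> = id"
  by (simp_all add: Sym_def permutes_inv_o)

lemma finite_Sym: "finite (Sym :: ('n::finite \<Rightarrow> 'n) set)"
  by simp

lemma Sym_nonempty: "Sym \<noteq> {}"
  using id_in_Sym by blast

lemma perm_vec_id: "perm_vec id x = x"
  by (simp add: perm_vec_def vec_eq_iff)

lemma perm_vec_inv: "\<rho> \<in> Sym \<Longrightarrow> perm_vec (inv \<rho>) (perm_vec \<rho> x) = x"
  by (simp add: perm_vec_comp[symmetric] inv_in_Sym inv_comp_Sym perm_vec_id)

lemma inj_perm_vec: "\<rho> \<in> Sym \<Longrightarrow> inj (perm_vec \<rho>)"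
  by (metis injI perm_vec_inv)

lemma perm_sig_comp:
  assumes "\<rho> \<in> Sym" "\<sigma> \<in> Sym"
  shows "perm_sig (\<rho> \<circ> \<sigma>) f = perm_sig \<rho> (perm_sig \<sigma> f)"
  using assms by (simp add: perm_sig_def o_inv_distrib bij_if_in_Sym perm_vec_comp inv_in_Sym)

lemma perm_sig_add: "perm_sig \<rho> (f + g) = perm_sig \<rho> f + perm_sig \<rho> g"
  by (simp add: perm_sig_def fun_eq_iff)

lemma perm_sig_scale: "perm_sig \<rho> (\<lambda>x. t * f x) = (\<lambda>x. t * perm_sig \<rho> f x)"
  by (simp add: perm_sig_def)

lemma perm_sig_sum: "perm_sig \<rho> (\<Sum>i\<in>I. f i) = (\<Sum>i\<in>I. perm_sig \<rho> (f i))"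
  by (simp add: perm_sig_def fun_eq_iff sum_fun_apply)

lemma perm_sig_C_AGE:
  assumes \<rho>: "\<rho> \<in> Sym" and "f \<in> C_AGE A \<beta>"
  shows "perm_sig \<rho> f \<in> C_AGE (perm_vec \<rho> ` A) (perm_vec \<rho> \<beta>)"
proof -
  obtain c where c: "f = (\<lambda>x. (\<Sum>\<alpha>\<in>A. c \<alpha> * expf \<alpha> x) + c \<beta> * expf \<beta> x)"
      "\<And>\<alpha>. \<alpha> \<in> A \<Longrightarrow> 0 \<le> c \<alpha>" "\<And>x. 0 \<le> f x"
    using assms(2) by (elim C_AGEE) blast
  let ?c = "\<lambda>\<gamma>. c (perm_vec (inv \<rho>) \<gamma>)"
  have inj: "inj_on (perm_vec \<rho>) A" using inj_perm_vec[OF \<rho>] by (rule inj_on_subset) simp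
  have "perm_sig \<rho> f x = (\<Sum>\<alpha>\<in>A. c \<alpha> * perm_sig \<rho> (expf \<alpha>) x) + c \<beta> * perm_sig \<rho> (expf \<beta>) x" for x
    by (simp add: c(1) perm_sig_def)
  then have "perm_sig \<rho> f = (\<lambda>x. (\<Sum>\<gamma>\<in>perm_vec \<rho> ` A. ?c \<gamma> * expf \<gamma> x)
      + ?c (perm_vec \<rho> \<beta>) * expf (perm_vec \<rho> \<beta>) x)"
    by (simp add: fun_eq_iff sum.reindex[OF inj] perm_sig_expf[OF \<rho>] perm_vec_inv[OF \<rho>])
  then show ?thesis
  proof (rule C_AGEI)
    show "0 \<le> ?c \<gamma>" if "\<gamma> \<in> perm_vec \<rho> ` A" for \<gamma> using that c(2) by (auto simp: perm_vec_inv[OF \<rho>])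
    show "0 \<le> perm_sig \<rho> f x" for x using c(3) by (simp add: perm_sig_def)
  qed
qed

definition symmetrize :: "'n::finite signomial \<Rightarrow> 'n signomial" where
  "symmetrize g = (\<Sum>\<rho>\<in>Sym. perm_sig \<rho> g)"

lemma symmetrize_zero: "symmetrize 0 = 0"
  by (simp add: symmetrize_def perm_sig_def fun_eq_iff sum_fun_apply)

lemma symmetrize_add: "symmetrize (f + g) = symmetrize f + symmetrize g"
  by (simp add: symmetrize_def perm_sig_add sum.distrib)

lemma symmetrize_scale: "symmetrize (\<lambda>x. t * f x) = (\<lambda>x. t * symmetrize f x)"
  by (simp add: symmetrize_def perm_sig_scale fun_eq_iff sum_fun_apply sum_distrib_left)

lemma symmetrize_sum: "symmetrize (\<Sum>i\<in>I. f i) = (\<Sum>i\<in>I. symmetrize (f i))"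
  by (simp add: symmetrize_def perm_sig_sum sum.swap[of _ I])

text \<open>
  Right translation by \<open>\<sigma>\<close> permutes the symmetric group. This is why one representative per orbit
  suffices in the decomposition.
\<close>

lemma symmetrize_perm_sig:
  assumes \<sigma>: "\<sigma> \<in> Sym"
  shows "symmetrize (perm_sig \<sigma> g) = symmetrize g"
proof -
  have "symmetrize (perm_sig \<sigma> g) = (\<Sum>\<rho>\<in>Sym. perm_sig (\<rho> \<circ> \<sigma>) g)"
    by (simp add: symmetrize_def perm_sig_comp \<sigma>)
  also have "\<dots> = symmetrize g" unfolding symmetrize_def
    by (rule sum.reindex_bij_witness[where i = "\<lambda>\<rho>. \<rho> \<circ> inv \<sigma>" and j = "\<lambda>\<rho>. \<rho> \<circ> \<sigma>"])
      (auto simp: comp_assoc inv_comp_Sym \<sigma> comp_in_Sym inv_in_Sym)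
  finally show ?thesis .
qed

lemma perm_sig_symmetrize:
  assumes \<sigma>: "\<sigma> \<in> Sym"
  shows "perm_sig \<sigma> (symmetrize g) = symmetrize g"
proof -
  have "perm_sig \<sigma> (symmetrize g) = (\<Sum>\<rho>\<in>Sym. perm_sig (\<sigma> \<circ> \<rho>) g)"
    by (simp add: symmetrize_def perm_sig_sum perm_sig_comp \<sigma>)
  also have "\<dots> = symmetrize g" unfolding symmetrize_def
    by (rule sum.reindex_bij_witness[where i = "\<lambda>\<rho>. inv \<sigma> \<circ> \<rho>" and j = "\<lambda>\<rho>. \<sigma> \<circ> \<rho>"])
      (auto simp: comp_assoc[symmetric] inv_comp_Sym \<sigma> comp_in_Sym inv_in_Sym)
  finally show ?thesis .
qed

lemma symmetrize_invariant:
  fixes f :: "'n::finite signomial"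
  assumes "\<And>\<rho>. \<rho> \<in> Sym \<Longrightarrow> perm_sig \<rho> f = f"
  shows "symmetrize f = (\<lambda>x. real (card (Sym :: ('n \<Rightarrow> 'n) set)) * f x)"
  using assms by (simp add: symmetrize_def fun_eq_iff sum_fun_apply)

lemma fun_cone_symmetrize_image:
  assumes K: "fun_cone K"
  shows "fun_cone (symmetrize ` K)"
proof (rule fun_coneI)
  show "0 \<in> symmetrize ` K" using fun_cone_zero[OF K] symmetrize_zero by (metis imageI)
next
  fix f g assume "f \<in> symmetrize ` K" "g \<in> symmetrize ` K"
  then show "f + g \<in> symmetrize ` K"
    by (auto simp: symmetrize_add[symmetric] intro!: imageI fun_cone_add[OF K])
next
  fix t :: real and f assume "0 \<le> t" "f \<in> symmetrize ` K"
  then show "(\<lambda>x. t * f x) \<in> symmetrize ` K"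
    by (auto simp: symmetrize_scale[symmetric] intro!: imageI fun_cone_scale[OF K])
qed

lemma fun_cone_symmetrize_vimage:
  assumes K: "fun_cone K"
  shows "fun_cone {g. symmetrize g \<in> K}"
  by (rule fun_coneI) (auto simp: symmetrize_zero symmetrize_add symmetrize_scale
      intro: fun_cone_zero[OF K] fun_cone_add[OF K] fun_cone_scale[OF K])

lemma C_SAGE_sym_circuit_eq_image:
  "C_SAGE_sym_circuit \<nu> = symmetrize ` C_AGE (circuit_pos \<nu>) (circuit_neg \<nu>)"
  by (auto simp: C_SAGE_sym_circuit_def symmetrize_def)

lemma fun_cone_nonneg_ray: "fun_cone (nonneg_ray f)"
proof (rule fun_coneI)
  show "0 \<in> nonneg_ray f" unfolding nonneg_ray_def by (auto intro!: exI[of _ 0] simp: fun_eq_iff)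
next
  fix g h assume "g \<in> nonneg_ray f" "h \<in> nonneg_ray f"
  then obtain s t where st: "0 \<le> s" "0 \<le> t" and gh: "g = (\<lambda>x. s * f x)" "h = (\<lambda>x. t * f x)"
    unfolding nonneg_ray_def by blast
  have "g + h = (\<lambda>x. (s + t) * f x)" by (simp add: gh fun_eq_iff algebra_simps)
  then show "g + h \<in> nonneg_ray f" unfolding nonneg_ray_def using add_nonneg_nonneg[OF st] by blast
next
  fix t :: real and g assume t: "0 \<le> t" "g \<in> nonneg_ray f"
  then obtain s where s: "0 \<le> s" "g = (\<lambda>x. s * f x)" unfolding nonneg_ray_def by blast
  have "(\<lambda>x. t * g x) = (\<lambda>x. (t * s) * f x)" by (simp add: s(2) mult.assoc)
  then show "(\<lambda>x. t * g x) \<in> nonneg_ray f"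
    unfolding nonneg_ray_def using mult_nonneg_nonneg[OF t(1) s(1)] by blast
qed

lemma self_in_coset: "\<rho> \<in> Sym \<Longrightarrow> \<rho> \<in> (\<lambda>\<sigma>. \<rho> \<circ> \<sigma>) ` Stab \<alpha>"
  by (auto simp: Stab_def perm_vec_id id_in_Sym intro!: image_eqI[of _ _ id])

lemma coset_eq_iff:
  assumes "\<rho> \<in> Sym" "\<tau> \<in> Sym"
  shows "(\<lambda>\<sigma>. \<tau> \<circ> \<sigma>) ` Stab \<alpha> = (\<lambda>\<sigma>. \<rho> \<circ> \<sigma>) ` Stab \<alpha> \<longleftrightarrow> \<tau> \<in> (\<lambda>\<sigma>. \<rho> \<circ> \<sigma>) ` Stab \<alpha>"
proof
  assume "\<tau> \<in> (\<lambda>\<sigma>. \<rho> \<circ> \<sigma>) ` Stab \<alpha>"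
  then obtain \<pi> where \<pi>: "\<pi> \<in> Stab \<alpha>" "\<tau> = \<rho> \<circ> \<pi>" by blast
  have \<pi>S: "\<pi> \<in> Sym" "perm_vec \<pi> \<alpha> = \<alpha>" using \<pi>(1) by (auto simp: Stab_def)
  have "perm_vec (inv \<pi>) \<alpha> = \<alpha>" using perm_vec_inv[OF \<pi>S(1), of \<alpha>] \<pi>S(2) by simp
  then have inv: "inv \<pi> \<in> Stab \<alpha>" using \<pi>S(1) by (simp add: Stab_def inv_in_Sym)
  have closed: "\<sigma> \<circ> \<sigma>' \<in> Stab \<alpha>" if "\<sigma> \<in> Stab \<alpha>" "\<sigma>' \<in> Stab \<alpha>" for \<sigma> \<sigma>'
    using that by (auto simp: Stab_def comp_in_Sym perm_vec_comp)
  have "(\<lambda>\<sigma>. \<pi> \<circ> \<sigma>) ` Stab \<alpha> = Stab \<alpha>"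
  proof (intro equalityI subsetI)
    fix \<sigma> assume "\<sigma> \<in> Stab \<alpha>"
    then have "inv \<pi> \<circ> \<sigma> \<in> Stab \<alpha>" by (intro closed inv)
    moreover have "\<sigma> = \<pi> \<circ> (inv \<pi> \<circ> \<sigma>)" by (simp add: comp_assoc[symmetric] inv_comp_Sym \<pi>S)
    ultimately show "\<sigma> \<in> (\<lambda>\<sigma>. \<pi> \<circ> \<sigma>) ` Stab \<alpha>" by (rule image_eqI[of _ "\<lambda>\<sigma>. \<pi> \<circ> \<sigma>", rotated])
  qed (use closed \<pi> in auto)
  then have "(\<lambda>\<sigma>. \<rho> \<circ> \<sigma>) ` ((\<lambda>\<sigma>. \<pi> \<circ> \<sigma>) ` Stab \<alpha>) = (\<lambda>\<sigma>. \<rho> \<circ> \<sigma>) ` Stab \<alpha>" by simp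
  then show "(\<lambda>\<sigma>. \<tau> \<circ> \<sigma>) ` Stab \<alpha> = (\<lambda>\<sigma>. \<rho> \<circ> \<sigma>) ` Stab \<alpha>"
    by (simp add: \<pi>(2) image_image comp_assoc)
qed (use self_in_coset[OF assms(2), of \<alpha>] in blast)

text \<open>
  The permutations in one coset of the stabilizer all give the same exponential, and all cosets have
  as many elements as the stabilizer.
\<close>

lemma symmetrize_expf_eq_orbit_sum:
  fixes \<alpha> :: "real ^ 'n::finite"
  shows "symmetrize (expf \<alpha>) = (\<lambda>x. real (card (Stab \<alpha>)) * orbit_sum_exp \<alpha> x)"
proof
  fix x
  let ?coset = "\<lambda>\<rho>. (\<lambda>\<sigma>. \<rho> \<circ> \<sigma>) ` Stab \<alpha>"
  have fibre: "(\<Sum>\<rho> | \<rho> \<in> Sym \<and> ?coset \<rho> = C. perm_sig \<rho> (expf \<alpha>) x)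
      = real (card (Stab \<alpha>)) * perm_sig (SOME \<rho>. \<rho> \<in> C) (expf \<alpha>) x"
    if C: "C \<in> Stab_cosets \<alpha>" for C
  proof -
    obtain \<pi> where \<pi>: "\<pi> \<in> Sym" "C = ?coset \<pi>" using C by (auto simp: Stab_cosets_def)
    have "C \<subseteq> Sym" using \<pi> by (auto simp: Stab_def comp_in_Sym)
    then have fibre_eq: "{\<rho>. \<rho> \<in> Sym \<and> ?coset \<rho> = C} = C"
      using coset_eq_iff[OF \<pi>(1), of _ \<alpha>] unfolding \<pi>(2) by blast
    have "inj_on (\<lambda>\<sigma>. \<pi> \<circ> \<sigma>) (Stab \<alpha>)"
    proof (rule inj_onI)
      fix \<sigma> \<tau> assume "\<pi> \<circ> \<sigma> = \<pi> \<circ> \<tau>"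
      then have "inv \<pi> \<circ> \<pi> \<circ> \<sigma> = inv \<pi> \<circ> \<pi> \<circ> \<tau>" by (simp add: comp_assoc)
      then show "\<sigma> = \<tau>" by (simp add: inv_comp_Sym \<pi>(1))
    qed
    then have card: "card C = card (Stab \<alpha>)" by (simp add: \<pi>(2) card_image)
    have some: "(SOME \<rho>. \<rho> \<in> C) \<in> C"
      using self_in_coset[OF \<pi>(1), of \<alpha>] unfolding \<pi>(2)[symmetric] by (auto simp: some_in_eq)
    have "(\<Sum>\<rho>\<in>C. perm_sig \<rho> (expf \<alpha>) x) = (\<Sum>\<rho>\<in>C. perm_sig (SOME \<rho>. \<rho> \<in> C) (expf \<alpha>) x)"
      by (intro sum.cong refl fun_cong[OF perm_sig_expf_coset[OF C _ some]])
    then show ?thesis by (simp add: fibre_eq card)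
  qed
  have "symmetrize (expf \<alpha>) x = (\<Sum>\<rho>\<in>Sym. perm_sig \<rho> (expf \<alpha>) x)"
    by (simp add: symmetrize_def sum_fun_apply)
  also have "\<dots> = (\<Sum>C\<in>Stab_cosets \<alpha>. \<Sum>\<rho> | \<rho> \<in> Sym \<and> ?coset \<rho> = C. perm_sig \<rho> (expf \<alpha>) x)"
    unfolding Stab_cosets_def by (rule sum.image_gen[OF finite_Sym])
  also have "\<dots> = real (card (Stab \<alpha>)) * orbit_sum_exp \<alpha> x"
    by (simp add: fibre orbit_sum_exp_def sum_fun_apply sum_distrib_left)
  finally show "symmetrize (expf \<alpha>) x = real (card (Stab \<alpha>)) * orbit_sum_exp \<alpha> x" .
qed

section \<open>The decomposition\<close>

lemma fun_cone_C_SAGE: "fun_cone (C_SAGE T)"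
  unfolding C_SAGE_def by (intro fun_cone_set_sum fun_cone_C_AGE)

lemma C_AGE_subset_C_SAGE:
  assumes "finite T" "\<beta> \<in> T"
  shows "C_AGE (T - {\<beta>}) \<beta> \<subseteq> C_SAGE T"
  unfolding C_SAGE_def
  using summand_subset_set_sum[OF assms, of "\<lambda>\<beta>. C_AGE (T - {\<beta>}) \<beta>"] fun_cone_C_AGE by blast

lemma perm_sig_C_SAGE:
  assumes T: "finite T" and inv: "sym_invariant_set T" and \<rho>: "\<rho> \<in> Sym" and f: "f \<in> C_SAGE T"
  shows "perm_sig \<rho> f \<in> C_SAGE T"
proof -
  obtain s where s: "f = (\<Sum>\<beta>\<in>T. s \<beta>)" "\<And>\<beta>. \<beta> \<in> T \<Longrightarrow> s \<beta> \<in> C_AGE (T - {\<beta>}) \<beta>"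
    using f unfolding C_SAGE_def set_sum_alt[OF T] by auto
  have img: "perm_vec \<rho> ` T = T" using inv \<rho> by (simp add: sym_invariant_set_def)
  have "perm_sig \<rho> (s \<beta>) \<in> C_SAGE T" if \<beta>: "\<beta> \<in> T" for \<beta>
  proof -
    have "perm_vec \<rho> ` (T - {\<beta>}) = T - {perm_vec \<rho> \<beta>}"
      using img inj_perm_vec[OF \<rho>] by (simp add: image_set_diff)
    then have "perm_sig \<rho> (s \<beta>) \<in> C_AGE (T - {perm_vec \<rho> \<beta>}) (perm_vec \<rho> \<beta>)"
      using perm_sig_C_AGE[OF \<rho> s(2)[OF \<beta>]] by simp
    then show ?thesis using C_AGE_subset_C_SAGE[OF T, of "perm_vec \<rho> \<beta>"] img \<beta> by blast
  qed
  then show ?thesis unfolding s(1) perm_sig_sum by (intro fun_cone_sum fun_cone_C_SAGE)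
qed

lemma symmetrize_in_C_SAGE_sym:
  assumes "finite T" "sym_invariant_set T" "g \<in> C_SAGE T"
  shows "symmetrize g \<in> C_SAGE_sym T"
proof -
  have "symmetrize g \<in> C_SAGE T"
    unfolding symmetrize_def using perm_sig_C_SAGE assms by (intro fun_cone_sum fun_cone_C_SAGE) blast
  then show ?thesis by (simp add: C_SAGE_sym_def perm_sig_symmetrize)
qed

lemma fun_cone_C_SAGE_sym: "fun_cone (C_SAGE_sym T)"
proof (rule fun_coneI)
  show "0 \<in> C_SAGE_sym T"
    using fun_cone_zero[OF fun_cone_C_SAGE] by (simp add: C_SAGE_sym_def perm_sig_def fun_eq_iff)
next
  fix f g assume "f \<in> C_SAGE_sym T" "g \<in> C_SAGE_sym T"
  then show "f + g \<in> C_SAGE_sym T"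
    by (simp add: C_SAGE_sym_def perm_sig_add fun_cone_add[OF fun_cone_C_SAGE])
next
  fix t :: real and f assume "0 \<le> t" "f \<in> C_SAGE_sym T"
  then show "(\<lambda>x. t * f x) \<in> C_SAGE_sym T"
    by (simp add: C_SAGE_sym_def perm_sig_scale fun_cone_scale[OF fun_cone_C_SAGE])
qed

lemma C_AGE_circuit_subset_C_SAGE:
  assumes T: "finite T" and \<nu>: "\<nu> \<in> normalized_circuits T"
  shows "C_AGE (circuit_pos \<nu>) (circuit_neg \<nu>) \<subseteq> C_SAGE T"
proof -
  have s: "simplicial_circuit T \<nu>" using \<nu> by (simp add: normalized_circuits_def)
  have neg: "\<nu> (circuit_neg \<nu>) < 0" using circuit_neg_iff[OF s] by blast
  then have "circuit_neg \<nu> \<in> T" using s unfolding simplicial_circuit_def by (metis less_irrefl)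
  moreover have "circuit_pos \<nu> \<subseteq> T - {circuit_neg \<nu>}"
    using circuit_pos_subset[OF s] neg by (auto simp: circuit_pos_def)
  ultimately show ?thesis
    using C_AGE_mono[of "T - {circuit_neg \<nu>}" "circuit_pos \<nu>" "circuit_neg \<nu>"]
      C_AGE_subset_C_SAGE[OF T] T by blast
qed

lemma orbit_sum_exp_in_C_SAGE_sym:
  assumes T: "finite T" "sym_invariant_set T" and \<alpha>: "\<alpha> \<in> T"
  shows "orbit_sum_exp \<alpha> \<in> C_SAGE_sym T"
proof -
  have "expf \<alpha> \<in> C_SAGE T"
    using expf_in_C_AGE[of \<alpha> "T - {\<alpha>}"] C_AGE_subset_C_SAGE[OF T(1) \<alpha>] by blast
  from fun_cone_scale[OF fun_cone_C_SAGE_sym _ symmetrize_in_C_SAGE_sym[OF T this], of "1 / real (card (Stab \<alpha>))"]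
  have "(\<lambda>x. 1 / real (card (Stab \<alpha>)) * symmetrize (expf \<alpha>) x) \<in> C_SAGE_sym T" by simp
  moreover have "Stab \<alpha> \<noteq> {}"
    using id_in_Sym perm_vec_id[of \<alpha>] unfolding Stab_def by blast
  ultimately show ?thesis by (simp add: symmetrize_expf_eq_orbit_sum)
qed

text \<open>
  An invariant signomial is, up to the factor \<open>card Sym\<close>, the symmetrization of any of its
  decompositions into AGE signomials. Each AGE summand can be moved to an orbit representative without
  changing its symmetrization, and there it is decomposed into circuits and exponentials, taking as the
  target cone the signomials whose symmetrization lies in \<open>K\<close>.
\<close>

lemma C_SAGE_sym_subset_cone:
  fixes T R :: "(real ^ 'n::finite) set"
  assumes T: "finite T" "sym_invariant_set T" and R: "orbit_representatives T R" and K: "fun_cone K"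
    and circuits: "\<And>\<nu>. \<nu> \<in> normalized_circuits T \<Longrightarrow> circuit_neg \<nu> \<in> R \<Longrightarrow> C_SAGE_sym_circuit \<nu> \<subseteq> K"
    and orbits: "\<And>\<alpha>. \<alpha> \<in> R \<Longrightarrow> orbit_sum_exp \<alpha> \<in> K"
  shows "C_SAGE_sym T \<subseteq> K"
proof
  fix f :: "'n signomial" assume "f \<in> C_SAGE_sym T"
  then have "f \<in> C_SAGE T" and invf: "\<And>\<rho>. \<rho> \<in> Sym \<Longrightarrow> perm_sig \<rho> f = f"
    by (auto simp: C_SAGE_sym_def)
  then obtain s where s: "f = (\<Sum>\<beta>\<in>T. s \<beta>)" "\<And>\<beta>. \<beta> \<in> T \<Longrightarrow> s \<beta> \<in> C_AGE (T - {\<beta>}) \<beta>"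
    unfolding C_SAGE_def set_sum_alt[OF T(1)] by auto
  have RT: "R \<subseteq> T" using R by (simp add: orbit_representatives_def)
  have rep: "\<exists>r\<in>R. \<exists>\<rho>\<in>Sym. \<alpha> = perm_vec \<rho> r" if "\<alpha> \<in> T" for \<alpha>
    using R that unfolding orbit_representatives_def by blast
  have exps: "symmetrize (expf \<alpha>) \<in> K" if \<alpha>: "\<alpha> \<in> T" for \<alpha>
  proof -
    obtain r \<rho> where r: "r \<in> R" "\<rho> \<in> Sym" "\<alpha> = perm_vec \<rho> r" using rep[OF \<alpha>] by blast
    have "symmetrize (expf \<alpha>) = symmetrize (expf r)"
      using symmetrize_perm_sig[OF r(2), of "expf r"] by (simp add: perm_sig_expf r)
    then show ?thesis
      using fun_cone_scale[OF K _ orbits[OF r(1)]] by (simp add: symmetrize_expf_eq_orbit_sum)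
  qed
  have AGE: "C_AGE (T - {r}) r \<subseteq> {g. symmetrize g \<in> K}" if r: "r \<in> R" for r
  proof (rule C_AGE_subset_circuit_cone[OF T(1) _ fun_cone_symmetrize_vimage[OF K]])
    show "C_AGE (circuit_pos \<nu>) r \<subseteq> {g. symmetrize g \<in> K}"
      if "\<nu> \<in> normalized_circuits T" "circuit_neg \<nu> = r" for \<nu>
      using circuits[OF that(1)] that(2) r by (auto simp: C_SAGE_sym_circuit_eq_image)
  qed (use r RT exps in auto)
  have "symmetrize (s \<beta>) \<in> K" if \<beta>: "\<beta> \<in> T" for \<beta>
  proof -
    obtain r \<rho> where r: "r \<in> R" "\<rho> \<in> Sym" "\<beta> = perm_vec \<rho> r" using rep[OF \<beta>] by blast
    have inv_\<beta>: "perm_vec (inv \<rho>) \<beta> = r" by (simp add: r perm_vec_inv)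
    have "perm_vec (inv \<rho>) ` T = T" using T(2) inv_in_Sym[OF r(2)] by (simp add: sym_invariant_set_def)
    then have "perm_vec (inv \<rho>) ` (T - {\<beta>}) = T - {r}"
      using inj_perm_vec[OF inv_in_Sym[OF r(2)]] by (simp add: image_set_diff inv_\<beta>)
    then have "perm_sig (inv \<rho>) (s \<beta>) \<in> C_AGE (T - {r}) r"
      using perm_sig_C_AGE[OF inv_in_Sym[OF r(2)] s(2)[OF \<beta>]] by (simp add: inv_\<beta>)
    then have "symmetrize (perm_sig (inv \<rho>) (s \<beta>)) \<in> K" using AGE[OF r(1)] by blast
    then show ?thesis by (simp add: symmetrize_perm_sig inv_in_Sym r(2))
  qed
  then have "symmetrize f \<in> K" unfolding s(1) symmetrize_sum by (intro fun_cone_sum K)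
  then have "(\<lambda>x. real (card (Sym :: ('n \<Rightarrow> 'n) set)) * f x) \<in> K"
    using symmetrize_invariant[OF invf] by simp
  from fun_cone_scale[OF K _ this, of "1 / real (card (Sym :: ('n \<Rightarrow> 'n) set))"]
  show "f \<in> K" using Sym_nonempty[where 'a = 'n] by simp
qed

theorem theorem2p9:
  fixes T That :: "(real ^ 'n::finite) set"
  assumes "finite T" and "T \<noteq> {}"
    and "sym_invariant_set T"
    and "orbit_representatives T That"
  shows "C_SAGE_sym T =
    (\<Sum>\<beta>\<in>That. \<Sum>\<nu>\<in>{\<nu> \<in> normalized_circuits T. circuit_neg \<nu> = \<beta>}. C_SAGE_sym_circuit \<nu>)
    + (\<Sum>\<alpha>\<in>That. nonneg_ray (orbit_sum_exp \<alpha>))"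
    (is "_ = ?circuits + ?orbits")
proof
  note T = assms(1,3)
  have RT: "That \<subseteq> T" using assms(4) by (simp add: orbit_representatives_def)
  have fin: "finite That" "\<And>\<beta>. finite {\<nu> \<in> normalized_circuits T. circuit_neg \<nu> = \<beta>}"
    using RT T(1) finite_normalized_circuits by (auto intro: finite_subset)
  have cones: "fun_cone (C_SAGE_sym_circuit \<nu>)" for \<nu> :: "real ^ 'n \<Rightarrow> real"
    unfolding C_SAGE_sym_circuit_eq_image by (intro fun_cone_symmetrize_image fun_cone_C_AGE)
  have cone_c: "fun_cone ?circuits" and cone_o: "fun_cone ?orbits"
    by (intro fun_cone_set_sum cones fun_cone_nonneg_ray)+
  have left: "?circuits \<subseteq> ?circuits + ?orbits"
    by (rule subset_set_plus_cone[OF cone_o])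
  have right: "?orbits \<subseteq> ?circuits + ?orbits"
    by (subst add.commute) (rule subset_set_plus_cone[OF cone_c])
  show "C_SAGE_sym T \<subseteq> ?circuits + ?orbits"
  proof (rule C_SAGE_sym_subset_cone[OF T assms(4) fun_cone_set_plus[OF cone_c cone_o]])
    fix \<nu> assume \<nu>: "\<nu> \<in> normalized_circuits T" "circuit_neg \<nu> \<in> That"
    let ?I = "{\<mu> \<in> normalized_circuits T. circuit_neg \<mu> = circuit_neg \<nu>}"
    have "C_SAGE_sym_circuit \<nu> \<subseteq> (\<Sum>\<mu>\<in>?I. C_SAGE_sym_circuit \<mu>)"
      using \<nu> by (intro summand_subset_set_sum fin cones) auto
    also have "\<dots> \<subseteq> ?circuits"
      by (rule summand_subset_set_sum[OF fin(1) \<nu>(2),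
            where K = "\<lambda>\<beta>. \<Sum>\<mu>\<in>{\<mu> \<in> normalized_circuits T. circuit_neg \<mu> = \<beta>}. C_SAGE_sym_circuit \<mu>"])
        (intro fun_cone_set_sum cones)
    finally show "C_SAGE_sym_circuit \<nu> \<subseteq> ?circuits + ?orbits" using left by (rule subset_trans)
  next
    fix \<alpha> assume \<alpha>: "\<alpha> \<in> That"
    have "orbit_sum_exp \<alpha> \<in> nonneg_ray (orbit_sum_exp \<alpha>)"
      unfolding nonneg_ray_def by (auto intro!: exI[of _ 1])
    then have "orbit_sum_exp \<alpha> \<in> ?orbits"
      using summand_subset_set_sum[OF fin(1) \<alpha>, of "\<lambda>\<alpha>. nonneg_ray (orbit_sum_exp \<alpha>)"]
        fun_cone_nonneg_ray by blast
    then show "orbit_sum_exp \<alpha> \<in> ?circuits + ?orbits" using right by (rule subsetD[rotated])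
  qed
  have "?circuits \<subseteq> C_SAGE_sym T"
  proof (intro set_sum_subset_cone fun_cone_C_SAGE_sym)
    fix \<beta> \<nu> assume "\<nu> \<in> {\<nu> \<in> normalized_circuits T. circuit_neg \<nu> = \<beta>}"
    then have "C_AGE (circuit_pos \<nu>) (circuit_neg \<nu>) \<subseteq> C_SAGE T"
      by (intro C_AGE_circuit_subset_C_SAGE T) auto
    then show "C_SAGE_sym_circuit \<nu> \<subseteq> C_SAGE_sym T"
      unfolding C_SAGE_sym_circuit_eq_image using symmetrize_in_C_SAGE_sym[OF T] by blast
  qed
  moreover have "?orbits \<subseteq> C_SAGE_sym T"
  proof (intro set_sum_subset_cone fun_cone_C_SAGE_sym)
    fix \<alpha> assume "\<alpha> \<in> That"
    then have "orbit_sum_exp \<alpha> \<in> C_SAGE_sym T" using orbit_sum_exp_in_C_SAGE_sym[OF T] RT by blast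
    then show "nonneg_ray (orbit_sum_exp \<alpha>) \<subseteq> C_SAGE_sym T"
      unfolding nonneg_ray_def using fun_cone_scale[OF fun_cone_C_SAGE_sym] by blast
  qed
  ultimately have "?circuits + ?orbits \<subseteq> C_SAGE_sym T + C_SAGE_sym T" by (rule set_plus_mono2)
  also have "\<dots> \<subseteq> C_SAGE_sym T"
    using fun_cone_add[OF fun_cone_C_SAGE_sym] by (auto elim!: set_plus_elim)
  finally show "?circuits + ?orbits \<subseteq> C_SAGE_sym T" .
qed

end
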